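(* Let $m>1$ be an integer and let $\mathcal{N}\subset\mathfrak{sl}(2m,\mathbb{R})$ be the set of nilpotent matrices of index $2$ all of whose Jordan blocks have size $2$ (equivalently $x^2=0$ and $\mathrm{rank}\,x=m$). The set $\mathcal{N}$ is the union of two adjoint orbits of $\mathrm{SL}(2m,\mathbb{R})$, and neither of these two orbits $\mathcal{O}$ admits a Gibbs state, i.e. $\Omega_{\mathcal{O}}=\varnothing$.
   Context: $\kappa$ denotes the Killing form of $\mathfrak{sl}(2m,\mathbb{R})$. Adjoint orbits of $\mathfrak{sl}(2m,\mathbb{R})$ are the orbits of $\mathrm{SL}(2m,\mathbb{R})$ acting by conjugation. An adjoint orbit $\mathcal{O}$ carries the Kirillov–Kostant–Souriau symplectic form $\omega_{\mathcal{O}}$, given at $y\in\mathcal{O}$ by $\omega_{\mathcal{O}}(X^*,Y^* )(y)=\kappa(y,[X,Y])$ for $X,Y\in\mathfrak{sl}(2m,\mathbb{R})$, where $X^*$ is the fundamental vector field of $X$ for the adjoint action (value $[X,y]$ at $y$, up to a sign convention that does not affect $\omega_{\mathcal{O}}$). If $\dim\mathcal{O}=2d$, the Liouville volume form is $\lambda_{\mathcal{O}}=\omega_{\mathcal{O}}^{d}$, and $|\lambda_{\mathcal{O}}|$ is the associated positive density (measure). $\Omega_{\mathcal{O}}$ is the set of $\beta\in\mathfrak{sl}(2m,\mathbb{R})$ for which $Z(\beta)=\int_{\mathcal{O}} e^{-\kappa(y,\beta)}|\lambda_{\mathcal{O}}|(y)$ is finite; to each $\beta\in\Omega_{\mathcal{O}}$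 is associated the probability distribution $Z(\beta)^{-1}e^{-\kappa(y,\beta)}|\lambda_{\mathcal{O}}|(y)$, called a Gibbs state. *)

theory Defs
  imports
    "Jordan_Normal_Form.Jordan_Normal_Form"
    "HOL-Analysis.Analysis"
    "HOL-Combinatorics.Permutations"
begin

no_notation vec_index (infixl \<open>$\<close> 100)

definition sl :: "(real^'n^'n) set" where
  "sl = {X. Determinants.trace X = 0}"

definition lie_bracket :: "real^'n^'n \<Rightarrow> real^'n^'n \<Rightarrow> real^'n^'n" where
  "lie_bracket X Y = X ** Y - Y ** X"

text \<open>Trace of a linear endomorphism \<open>f\<close> of a finite-dimensional subspace \<open>S\<close>: the sum of the
  diagonal entries of its matrix in a basis of \<open>S\<close>, whose choice is immaterial.\<close>

definition endo_trace :: "'a::real_vector set \<Rightarrow> ('a \<Rightarrow> 'a) \<Rightarrow> real" where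
  "endo_trace S f =
     (let B = (SOME B. independent B \<and> span B = S) in \<Sum>b\<in>B. representation B (f b) b)"

definition killing :: "real^'n^'n \<Rightarrow> real^'n^'n \<Rightarrow> real" where
  "killing X Y = endo_trace sl (\<lambda>Z. lie_bracket X (lie_bracket Y Z))"

definition adjoint_orbit :: "real^'n^'n \<Rightarrow> (real^'n^'n) set" where
  "adjoint_orbit x = {g ** x ** matrix_inv g | g. Determinants.det g = 1}"

definition adjoint_orbits :: "(real^'n^'n) set set" where
  "adjoint_orbits = adjoint_orbit ` sl"

text \<open>The values at \<open>y\<close> of the fundamental vector fields, i.e. the tangent space at \<open>y\<close> of the
  orbit of \<open>y\<close>.\<close>

definition orbit_tangent :: "real^'n^'n \<Rightarrow> (real^'n^'n) set" where
  "orbit_tangent y = (\<lambda>X. lie_bracket X y) ` sl"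

definition orbit_dim :: "(real^'n^'n) set \<Rightarrow> nat" where
  "orbit_dim Orb = (THE k. \<forall>y\<in>Orb. dim (orbit_tangent y) = k)"

text \<open>For tangent vectors \<open>v = [X, y]\<close> and \<open>w = [Y, y]\<close> the value \<open>\<kappa>(y, [X, Y])\<close> does not depend on
  the choice of \<open>X\<close> and \<open>Y\<close>, because \<open>\<kappa>\<close> is invariant.\<close>

definition kks_form :: "real^'n^'n \<Rightarrow> real^'n^'n \<Rightarrow> real^'n^'n \<Rightarrow> real" where
  "kks_form y v w =
     (THE r. \<exists>X\<in>sl. \<exists>Y\<in>sl. v = lie_bracket X y \<and> w = lie_bracket Y y
               \<and> r = killing y (lie_bracket X Y))"

text \<open>The \<open>d\<close>-fold exterior power of a 2-form \<open>\<omega>\<close>, evaluated at \<open>v 0, \<dots>, v (2 * d - 1)\<close>.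
  The factor is that of the convention
  \<open>(\<alpha> \<and> \<beta>)(v\<^sub>1, \<dots>) = 1 / (p! q!) \<Sum>\<^sub>\<sigma> sgn \<sigma> \<alpha>(v\<^bsub>\<sigma> 1\<^esub>, \<dots>) \<beta>(\<dots>)\<close> for the exterior product.\<close>

definition wedge_power :: "('v \<Rightarrow> 'v \<Rightarrow> real) \<Rightarrow> nat \<Rightarrow> (nat \<Rightarrow> 'v) \<Rightarrow> real" where
  "wedge_power \<omega> d v =
     (1 / 2 ^ d) * (\<Sum>\<sigma> | \<sigma> permutes {..<2 * d}.
        of_int (sign \<sigma>) * (\<Prod>i<d. \<omega> (v (\<sigma> (2 * i))) (v (\<sigma> (2 * i + 1)))))"

text \<open>\<open>\<real>\<^sup>N\<close> is represented by the extensional functions on \<open>{..<N}\<close>, so that its dimension may depend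
  on the orbit; its Lebesgue measure is the product measure.\<close>

definition coord_space :: "nat \<Rightarrow> (nat \<Rightarrow> real) set" where
  "coord_space N = ({..<N} \<rightarrow>\<^sub>E UNIV)"

definition partial_deriv :: "nat \<Rightarrow> ((nat \<Rightarrow> real) \<Rightarrow> 'v::real_normed_vector) \<Rightarrow> (nat \<Rightarrow> real) \<Rightarrow> 'v" where
  "partial_deriv i \<phi> x = vector_derivative (\<lambda>t. \<phi> (x(i := t))) (at (x i))"

text \<open>Local parametrisations of an orbit: injective immersions of class \<open>C\<^sup>1\<close>, from an open subset of
  the coordinate space of the same dimension as the orbit. Adjoint orbits are embedded submanifolds,
  so by the inverse function theorem such a map is a diffeomorphism onto an open subset of the
  orbit.\<close>

definition orbit_chart ::
  "(real^'n^'n) set \<Rightarrow> (nat \<Rightarrow> real) set \<Rightarrow> ((nat \<Rightarrow> real) \<Rightarrow> real^'n^'n) \<Rightarrow> bool" where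
  "orbit_chart Orb U \<phi> \<longleftrightarrow>
     openin (top_of_set (coord_space (orbit_dim Orb))) U \<and>
     inj_on \<phi> U \<and> \<phi> ` U \<subseteq> Orb \<and>
     (\<forall>i<orbit_dim Orb. (\<forall>x\<in>U. (\<lambda>t. \<phi> (x(i := t))) differentiable at (x i)) \<and>
                        continuous_on U (partial_deriv i \<phi>)) \<and>
     (\<forall>x\<in>U. \<forall>c. (\<Sum>i<orbit_dim Orb. c i *\<^sub>R partial_deriv i \<phi> x) = 0
                   \<longrightarrow> (\<forall>i<orbit_dim Orb. c i = 0))"

text \<open>The absolute value of the coefficient of the pull-back of \<open>\<omega>\<^sup>d\<close> along \<open>\<phi>\<close>, where \<open>2 d\<close> is the
  dimension of the orbit.\<close>

definition chart_density ::
  "(real^'n^'n) set \<Rightarrow> ((nat \<Rightarrow> real) \<Rightarrow> real^'n^'n) \<Rightarrow> (nat \<Rightarrow> real) \<Rightarrow> real" where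
  "chart_density Orb \<phi> x =
     \<bar>wedge_power (kks_form (\<phi> x)) (orbit_dim Orb div 2) (\<lambda>i. partial_deriv i \<phi> x)\<bar>"

definition chart_measure ::
  "(real^'n^'n) set \<Rightarrow> (nat \<Rightarrow> real) set \<Rightarrow> ((nat \<Rightarrow> real) \<Rightarrow> real^'n^'n) \<Rightarrow> (real^'n^'n) measure" where
  "chart_measure Orb U \<phi> =
     distr (density (restrict_space (Pi\<^sub>M {..<orbit_dim Orb} (\<lambda>_. lborel)) U)
                    (\<lambda>x. ennreal (chart_density Orb \<phi> x)))
           borel \<phi>"

text \<open>The measure \<open>|\<omega>\<^sup>d|\<close>, as a Borel measure on the matrix space that is concentrated on the orbit.
  By the change of variables formula the measures of two charts agree on the intersection of
  their images; gluing such a family amounts to taking its supremum in the lattice of measures.\<close>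

definition liouville_measure :: "(real^'n^'n) set \<Rightarrow> (real^'n^'n) measure" where
  "liouville_measure Orb = Sup {chart_measure Orb U \<phi> | U \<phi>. orbit_chart Orb U \<phi>}"

definition partition_function :: "(real^'n^'n) set \<Rightarrow> real^'n^'n \<Rightarrow> ennreal" where
  "partition_function Orb \<beta> = (\<integral>\<^sup>+ y. ennreal (exp (- killing y \<beta>)) \<partial>liouville_measure Orb)"

definition gibbs_domain :: "(real^'n^'n) set \<Rightarrow> (real^'n^'n) set" where
  "gibbs_domain Orb = {\<beta> \<in> sl. partition_function Orb \<beta> < \<infinity>}"

text \<open>The two matrix representations are related by an enumeration \<open>f\<close> of the index type; all
  enumerations give similar matrices.\<close>

definition to_mat :: "(nat \<Rightarrow> 'n::finite) \<Rightarrow> real^'n^'n \<Rightarrow> real Matrix.mat" where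
  "to_mat f x = Matrix.mat CARD('n) CARD('n) (\<lambda>(i, j). x $ f i $ f j)"

definition jordan_form :: "real^'n^'n \<Rightarrow> (nat \<times> real) list \<Rightarrow> bool" where
  "jordan_form x n_as \<longleftrightarrow>
     (\<exists>f. bij_betw f {..<CARD('n)} (UNIV :: 'n set) \<and> jordan_nf (to_mat f x) n_as)"

definition nilpotents_2 :: "(real^'n^'n) set" where
  "nilpotents_2 = {x \<in> sl. x ** x = 0 \<and> x \<noteq> 0 \<and>
     (\<exists>n_as. jordan_form x n_as \<and> (\<forall>(k, a)\<in>set n_as. k = 2))}"

end

theory Submission
  imports Defs
begin

text \<open>In block form a nilpotent matrix with blocks of size 2 is \<open>g J g\<^sup>-\<^sup>1\<close> with \<open>J = (0 1; 0 0)\<close>; a matrix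
  commuting with \<open>J\<close> is \<open>(A B; 0 A)\<close> and has determinant \<open>(det A)\<^sup>2 \<ge> 0\<close>, so the sign of \<open>det g\<close>
  separates two orbits.  An open piece of each orbit is parametrised by
  \<open>(1 + C) B (1 - C)\<close>, where \<open>B\<close> is an invertible upper right block with determinant of fixed sign
  and \<open>C\<close> is an arbitrary lower left block.  The entries of \<open>B\<close> and \<open>C\<close> are Darboux coordinates, so
  the Liouville density is constant.  For fixed \<open>\<beta>\<close> and \<open>C\<close> the exponent is linear in \<open>B\<close>.  Changing
  the signs of an even number of rows of \<open>B\<close> preserves the domain and the measure, and for \<open>m > 1\<close> the
  mean of the exponent over all such changes is 0; since \<open>exp t \<ge> 1 + t\<close>, the partition function is
  bounded below by a multiple of the infinite volume of the domain.\<close>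

section \<open>The Killing form\<close>

text \<open>Divergence only needs a lower bound, and the Liouville measure is a supremum over
  charts, so a single chart of each orbit settles the matter. The infinite volume of its domain
  comes from the unrestricted entries of \<open>C\<close>, while a finite group of
  measure-preserving sign changes takes care of the exponential. For \<open>m = 1\<close> the only
  even sign change is the identity, and the cancellation breaks down. The index type carries neither
  an order nor blocks, and this shapes the constructions. An enumeration interleaves the two halves,
  even positions against odd ones, so that \<open>J\<close> becomes literally the Jordan matrix with
  blocks of size 2. Blocks are full-size matrices with prescribed support, and the determinant of a
  block \<open>B\<close> becomes the determinant of the full matrix \<open>frame\<close>.
  Coordinates are interleaved in the same way: \<open>2 * k\<close> for an entry of
  \<open>B\<close>, \<open>2 * k + 1\<close> for the transposed entry of \<open>C\<close>. The
  numerical constants stem from the Killing form, which is \<open>2 * n * trace (X ** Y)\<close> on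
  \<open>sl\<close> with \<open>n = 2 * m\<close>.\<close>

lemma sum_representation_eq_trace:
  fixes f :: "'a::euclidean_space \<Rightarrow> 'a"
  assumes "linear f" "independent B" "span B = UNIV"
  shows "(\<Sum>b\<in>B. representation B (f b) b) = (\<Sum>e\<in>Basis. f e \<bullet> e)"
proof -
  have fin: "finite B" using assms(2) by (rule independent_imp_finite)
  have rep: "linear (\<lambda>v. representation B v b)" for b
    using assms by (auto intro!: linearI simp: representation_add representation_scale)
  have "(\<Sum>b\<in>B. representation B (f b) b) = (\<Sum>b\<in>B. \<Sum>e\<in>Basis. (b \<bullet> e) * representation B (f e) b)"
  proof (rule sum.cong[OF refl])
    fix b assume "b \<in> B"
    have "f b = (\<Sum>e\<in>Basis. (b \<bullet> e) *\<^sub>R f e)"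
      by (metis (no_types, lifting) assms(1) euclidean_representation linear_scale linear_sum sum.cong)
    then show "representation B (f b) b = (\<Sum>e\<in>Basis. (b \<bullet> e) * representation B (f e) b)"
      by (simp add: linear_sum[OF rep] linear_scale[OF rep])
  qed
  \<comment> \<open>After swapping the sums, the inner sum over \<open>B\<close> is the expansion of
    \<open>f e\<close> in the basis \<open>B\<close>.\<close>
  also have "\<dots> = (\<Sum>e\<in>Basis. (\<Sum>b\<in>B. representation B (f e) b *\<^sub>R b) \<bullet> e)"
    by (subst sum.swap) (simp add: inner_sum_left mult.commute)
  also have "\<dots> = (\<Sum>e\<in>Basis. f e \<bullet> e)"
    using sum_representation_eq[of B] fin assms by simp
  finally show ?thesis .
qed

lemma trace_scaleR: "trace (c *\<^sub>R X) = c * trace (X :: real^'n^'n)"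
  by (simp add: trace_def sum_distrib_left)

lemma trace_zero: "trace (0 :: real^'n^'n) = 0"
  by (simp add: trace_def)

lemma subspace_sl: "subspace (sl :: (real^'n^'n) set)"
  by (rule subspaceI) (simp_all add: sl_def trace_add trace_scaleR trace_zero)

lemma lie_bracket_in_sl [simp]: "lie_bracket X Y \<in> sl"
  by (simp add: sl_def lie_bracket_def trace_sub trace_mul_sym[of X Y])

lemma trace_mat_1: "trace (mat 1 :: real^'n^'n) = CARD('n)"
  by (simp add: trace_def mat_def)

lemma matrix_mul_diff_left: "(A - B) ** C = A ** C - B ** (C :: real^'n^'n)"
  by (simp add: matrix_matrix_mult_def vec_eq_iff algebra_simps sum_subtractf)

lemma matrix_mul_diff_right: "C ** (A - B) = C ** A - C ** (B :: real^'n^'n)"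
  by (simp add: matrix_matrix_mult_def vec_eq_iff algebra_simps sum_subtractf)

lemma matrix_mul_minus_left: "(- A) ** C = - (A ** (C :: real^'n^'n))"
  by (simp add: matrix_matrix_mult_def vec_eq_iff sum_negf)

lemma matrix_mul_minus_right: "C ** (- A) = - (C ** (A :: real^'n^'n))"
  by (simp add: matrix_matrix_mult_def vec_eq_iff sum_negf)

lemma matrix_mul_scaleR_left: "(c *\<^sub>R A) ** B = c *\<^sub>R (A ** (B :: real^'n^'n))"
  by (simp add: matrix_matrix_mult_def vec_eq_iff sum_distrib_left mult.assoc)

lemma matrix_mul_scaleR_right: "A ** (c *\<^sub>R B) = c *\<^sub>R (A ** (B :: real^'n^'n))"
  by (simp add: matrix_matrix_mult_def vec_eq_iff sum_distrib_left mult.left_commute)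

lemma matrix_add_rdistrib: "(A + B) ** C = A ** C + B ** (C :: real^'n^'n)"
  by (simp add: matrix_matrix_mult_def vec_eq_iff algebra_simps sum.distrib)

lemmas matrix_algebra = matrix_add_ldistrib matrix_add_rdistrib matrix_mul_diff_left
  matrix_mul_diff_right matrix_mul_scaleR_left matrix_mul_scaleR_right matrix_mul_assoc[symmetric]
  matrix_mul_minus_left matrix_mul_minus_right

definition munit :: "'n \<Rightarrow> 'n \<Rightarrow> real^'n^'n" where
  "munit i j = (\<chi> a b. if a = i \<and> b = j then 1 else 0)"

lemma munit_nth: "munit i j $ a $ b = (if a = i \<and> b = j then 1 else 0)"
  by (simp add: munit_def)

lemma munit_mult_nth: "(munit i j ** X) $ a $ b = (if a = i then X $ j $ b else 0)"
  by (simp add: munit_def matrix_matrix_mult_def if_distrib[of "\<lambda>x. x * _"] cong: if_cong)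

lemma mult_munit_nth: "(X ** munit i j) $ a $ b = (if b = j then X $ a $ i else 0)"
  by (simp add: munit_def matrix_matrix_mult_def if_distrib[of "\<lambda>x. _ * x"] cong: if_cong)

lemma munit_mult_munit: "munit i j ** munit k l = (if j = k then munit i l else 0)"
  by (simp add: vec_eq_iff munit_mult_nth munit_nth)

lemma trace_munit: "trace (munit i j) = (if i = j then 1 else 0)"
  by (cases "i = j") (auto simp: trace_def munit_nth intro!: sum.neutral)

lemma sum_Basis_matrix:
  "(\<Sum>e\<in>Basis. g e) = (\<Sum>i\<in>UNIV. \<Sum>j\<in>UNIV. g (munit i j :: real^'n^'n))"
proof -
  have eq: "(axis i (axis j 1) :: real^'n^'n) = munit i j" for i j
    by (auto simp: vec_eq_iff axis_def munit_nth)
  have inj: "inj (\<lambda>p. munit (fst p) (snd p) :: real^'n^'n)"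
  proof (rule injI)
    fix p q :: "'n \<times> 'n"
    assume "munit (fst p) (snd p) = (munit (fst q) (snd q) :: real^'n^'n)"
    then have "munit (fst p) (snd p) $ fst p $ snd p = (munit (fst q) (snd q) :: real^'n^'n) $ fst p $ snd p"
      by simp
    then show "p = q" by (simp add: munit_nth prod_eq_iff split: if_splits)
  qed
  have Basis: "(Basis :: (real^'n^'n) set) = range (\<lambda>p. munit (fst p) (snd p))"
    by (force simp: Basis_vec_def eq image_iff)
  have "(\<Sum>e\<in>Basis. g e) = (\<Sum>p\<in>UNIV. g (munit (fst p) (snd p) :: real^'n^'n))"
    unfolding Basis by (subst sum.reindex[OF inj]) simp
  also have "\<dots> = (\<Sum>i\<in>UNIV. \<Sum>j\<in>UNIV. g (munit i j))"
    by (subst sum.cartesian_product) (simp add: case_prod_unfold)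
  finally show ?thesis .
qed

text \<open>The trace over \<open>sl\<close> is moved to the space of all matrices: the identity
  extends a basis of \<open>sl\<close> to a full basis, and the endomorphism kills the identity and
  takes values in \<open>sl\<close>, so the trace does not change. There it is read off from the
  matrix units, whatever basis \<open>SOME\<close> has picked.\<close>

lemma killing_eq:
  "killing X Y = 2 * CARD('n) * trace (X ** Y) - 2 * trace X * trace (Y :: real^'n^'n)"
proof -
  define f where "f = (\<lambda>Z. lie_bracket X (lie_bracket Y Z))"
  define B :: "(real^'n^'n) set" where "B = (SOME B. independent B \<and> span B = sl)"
  have "\<exists>B :: (real^'n^'n) set. independent B \<and> span B = sl"
    by (metis basis_exists span_subspace subspace_sl)
  then have B: "independent B" "span B = sl"
    unfolding B_def by (metis (mono_tags, lifting) someI_ex)+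
  have one: "mat 1 \<notin> span B" by (simp add: B sl_def trace_mat_1)
  have B': "independent (insert (mat 1) B)"
    using B one by (simp add: independent_insertI)
  have lin: "linear f"
    by (rule linearI) (simp_all add: f_def lie_bracket_def matrix_algebra algebra_simps)
  have "Z \<in> span (insert (mat 1) B)" for Z :: "real^'n^'n"
  proof -
    have "Z - (trace Z / CARD('n)) *\<^sub>R mat 1 \<in> sl"
      by (simp add: sl_def trace_sub trace_scaleR trace_mat_1)
    then show ?thesis by (auto simp: span_insert B)
  qed
  then have sp: "span (insert (mat 1) B) = UNIV" by auto
  have fsl: "f Z \<in> span B" for Z by (simp add: f_def B)
  have fin: "finite B" using B(1) by (rule independent_imp_finite)
  have f1: "f (mat 1) = 0" by (simp add: f_def lie_bracket_def)
  have "killing X Y = (\<Sum>b\<in>B. representation B (f b) b)"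
    by (simp add: killing_def endo_trace_def B_def[symmetric] f_def Let_def)
  also have "\<dots> = (\<Sum>b\<in>insert (mat 1) B. representation (insert (mat 1) B) (f b) b)"
  proof -
    have "b \<noteq> mat 1" if "b \<in> B" for b using one that by (auto simp: span_base)
    moreover have "mat 1 \<notin> B" using one by (auto simp: span_base)
    moreover have "representation (insert (mat 1) B) (f b) = representation B (f b)" for b
      by (rule representation_extend[OF B' fsl]) auto
    ultimately show ?thesis
      using fin f1 by (simp add: representation_zero)
  qed
  also have "\<dots> = (\<Sum>i\<in>UNIV. \<Sum>j\<in>UNIV. f (munit i j) \<bullet> munit i j)"
    unfolding sum_representation_eq_trace[OF lin B' sp] by (rule sum_Basis_matrix)
  \<comment> \<open>The four terms of \<open>X Y Z - X Z Y - Y Z X + Z Y X\<close> at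
    \<open>Z = munit i j\<close>, each read at the entry \<open>(i, j)\<close>.\<close>
  also have "\<dots> = (\<Sum>i\<in>UNIV. \<Sum>j\<in>UNIV. (X ** Y) $ i $ i - X $ i $ i * Y $ j $ j
       - Y $ i $ i * X $ j $ j + (Y ** X) $ j $ j)"
  proof (intro sum.cong refl)
    fix i j
    have "Z \<bullet> munit i j = Z $ i $ j" for Z :: "real^'n^'n"
    proof -
      have "Z \<bullet> munit i j = Z \<bullet> axis i (axis j 1)"
        by (rule arg_cong[of _ _ "inner Z"]) (auto simp: vec_eq_iff axis_def munit_nth)
      then show ?thesis by (simp add: inner_axis)
    qed
    moreover have "(X ** munit i j ** Y) $ i $ j = X $ i $ i * Y $ j $ j" for X Y :: "real^'n^'n"
      by (simp add: matrix_matrix_mult_def[of "X ** munit i j"] mult_munit_nth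
          if_distrib[of "\<lambda>x. x * _"] cong: if_cong)
    ultimately show "f (munit i j) \<bullet> munit i j = (X ** Y) $ i $ i - X $ i $ i * Y $ j $ j
       - Y $ i $ i * X $ j $ j + (Y ** X) $ j $ j"
      by (simp add: f_def lie_bracket_def matrix_mul_diff_left matrix_mul_diff_right matrix_mul_assoc
          mult_munit_nth)
         (simp add: munit_mult_nth flip: matrix_mul_assoc)
  qed
  also have "\<dots> = 2 * CARD('n) * trace (X ** Y) - 2 * trace X * trace Y"
    by (simp add: sum.distrib sum_subtractf trace_mul_sym[of Y X] trace_def[of X] trace_def[of Y]
        flip: sum_distrib_left sum_distrib_right)
       (simp add: trace_mul_sym[of Y X] flip: trace_def)
  finally show ?thesis .
qed

section \<open>Exterior powers of a form in a Darboux basis\<close>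

text \<open>The conjugate index in a Darboux basis whose conjugate pairs are \<open>2 * i\<close>
  and \<open>2 * i + 1\<close>.\<close>

definition partner :: "nat \<Rightarrow> nat" where
  "partner k = (if even k then Suc k else k - 1)"

text \<open>The value of the standard symplectic form on the basis vectors \<open>k\<close> and
  \<open>partner k\<close>.\<close>

definition parity_sign :: "nat \<Rightarrow> int" where
  "parity_sign k = (if even k then 1 else - 1)"

lemma partner_partner [simp]: "partner (partner k) = k"
  by (auto simp: partner_def)

lemma even_partner [simp]: "even (partner k) \<longleftrightarrow> odd k"
  by (auto simp: partner_def)

lemma partner_less: "k < 2 * d \<Longrightarrow> partner k < 2 * d"
  unfolding partner_def by presburger

text \<open>Induction on the number of pairs: the last pair is moved home by two transpositions, which do not
  change the sign, and possibly by one swap inside the pair, which \<open>parity_sign\<close> counts.\<close>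

lemma sign_pair_permutation:
  assumes "\<sigma> permutes {..<2 * d}" "\<And>i. i < d \<Longrightarrow> \<sigma> (2 * i + 1) = partner (\<sigma> (2 * i))"
  shows "sign \<sigma> * (\<Prod>i<d. parity_sign (\<sigma> (2 * i))) = 1"
  using assms
proof (induction d arbitrary: \<sigma>)
  case 0
  then show ?case by (simp add: permutes_empty)
next
  case (Suc d)
  \<comment> \<open>Here the last pair is mapped in increasing order; the opposite order is reduced
    to this case below.\<close>
  have ordered: "sign \<pi> * (\<Prod>i<Suc d. parity_sign (\<pi> (2 * i))) = 1"
    if \<pi>: "\<pi> permutes {..<2 * Suc d}" "\<And>i. i < Suc d \<Longrightarrow> \<pi> (2 * i + 1) = partner (\<pi> (2 * i))"
      and even: "even (\<pi> (2 * d))" for \<pi>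
  proof -
    define a where "a = \<pi> (2 * d)"
    have a1: "\<pi> (2 * d + 1) = Suc a" using \<pi>(2)[of d] even by (simp add: a_def partner_def)
    have alt: "a < 2 * Suc d" using permutes_in_image[OF \<pi>(1), of "2 * d"] by (simp add: a_def)
    have ev: "even a" using even by (simp add: a_def)
    have neq: "Suc a \<noteq> 2 * d" using ev by presburger
    \<comment> \<open>This exchanges the pair starting at \<open>2 * d\<close> with the pair
      starting at \<open>a\<close>. If \<open>a = 2 * d\<close>, both transpositions are the
      identity, so the sign is 1 in either case.\<close>
    define \<tau> where "\<tau> = Transposition.transpose (2 * d) a \<circ> Transposition.transpose (Suc (2 * d)) (Suc a)"
    have \<tau>: "\<tau> k = (if k = 2 * d then a else if k = a then 2 * d else
                  if k = Suc (2 * d) then Suc a else if k = Suc a then Suc (2 * d) else k)" for k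
      using ev neq by (auto simp: \<tau>_def Transposition.transpose_def)
    have perm: "\<tau> permutes {..<2 * Suc d}"
      unfolding \<tau>_def using alt ev by (intro permutes_compose permutes_swap_id) (auto, presburger)
    have sgn: "sign \<tau> = 1"
      unfolding \<tau>_def by (subst sign_compose) (auto simp: sign_swap_id permutation_swap_id)
    have \<rho>: "\<tau> \<circ> \<pi> permutes {..<2 * Suc d}"
      using \<pi>(1) perm by (rule permutes_compose)
    have fixed: "(\<tau> \<circ> \<pi>) (2 * d) = 2 * d" "(\<tau> \<circ> \<pi>) (2 * d + 1) = 2 * d + 1"
      using a1 ev unfolding o_def by (auto simp: \<tau> simp flip: a_def)
    have "\<tau> \<circ> \<pi> permutes {..<2 * d}"
    proof (rule permutes_superset[OF \<rho>])
      fix k assume "k \<in> {..<2 * Suc d} - {..<2 * d}"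
      then have "k = 2 * d \<or> k = 2 * d + 1" by auto
      then show "(\<tau> \<circ> \<pi>) k = k" using fixed by auto
    qed
    \<comment> \<open>Pairs are moved as wholes and in order, so the pairing hypothesis survives the
      composition and the induction hypothesis applies.\<close>
    moreover have "\<tau> (partner k) = partner (\<tau> k)" for k
    proof -
      obtain c where c: "a = 2 * c" using ev by (elim evenE)
      obtain j where "k = 2 * j \<or> k = Suc (2 * j)" by (metis evenE oddE Suc_eq_plus1)
      moreover have neq: "2 * x \<noteq> Suc (2 * y)" "Suc (2 * x) \<noteq> 2 * y" for x y :: nat by presburger+
      have "\<tau> (2 * j) = 2 * (if j = d then c else if j = c then d else j)"
        "\<tau> (Suc (2 * j)) = Suc (2 * (if j = d then c else if j = c then d else j))"
        by (simp_all add: \<tau> c neq)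
      moreover have "partner (2 * x) = Suc (2 * x)" "partner (Suc (2 * x)) = 2 * x" for x
        by (simp_all add: partner_def)
      ultimately show ?thesis by (elim disjE) simp_all
    qed
    then have "(\<tau> \<circ> \<pi>) (2 * i + 1) = partner ((\<tau> \<circ> \<pi>) (2 * i))" if "i < d" for i
      using \<pi>(2)[of i] that by simp
    ultimately have IH: "sign (\<tau> \<circ> \<pi>) * (\<Prod>i<d. parity_sign ((\<tau> \<circ> \<pi>) (2 * i))) = 1"
      by (rule Suc.IH)
    have "sign (\<tau> \<circ> \<pi>) = sign \<pi>"
      using sgn perm \<pi>(1) by (subst sign_compose) (auto simp: permutation_permutes)
    moreover have "parity_sign (\<tau> k) = parity_sign k" for k
      using ev by (auto simp: parity_sign_def \<tau>)
    ultimately show ?thesis using IH even by (simp add: parity_sign_def)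
  qed
  show ?case
  proof (cases "even (\<sigma> (2 * d))")
    case True
    then show ?thesis using ordered[of \<sigma>] Suc.prems by blast
  next
    case False
    \<comment> \<open>Precomposing with the swap of the last pair negates both the sign of the
      permutation and exactly one parity factor, so the product is unchanged.\<close>
    define t where "t = Transposition.transpose (2 * d) (Suc (2 * d))"
    have t: "t k = (if k = 2 * d then Suc (2 * d) else if k = Suc (2 * d) then 2 * d else k)" for k
      by (auto simp: t_def Transposition.transpose_def)
    have tp: "t permutes {..<2 * Suc d}" unfolding t_def by (intro permutes_swap_id) auto
    have ti: "t (2 * i) = 2 * i" "t (Suc (2 * i)) = Suc (2 * i)" if "i < d" for i
      using that by (simp_all add: t)
    have td: "t (2 * d) = Suc (2 * d)" "t (Suc (2 * d)) = 2 * d" by (simp_all add: t)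
    have p: "\<sigma> (Suc (2 * d)) = partner (\<sigma> (2 * d))" using Suc.prems(2)[of d] by simp
    have "sign (\<sigma> \<circ> t) * (\<Prod>i<Suc d. parity_sign ((\<sigma> \<circ> t) (2 * i))) = 1"
    proof (rule ordered)
      show "\<sigma> \<circ> t permutes {..<2 * Suc d}" using tp Suc.prems(1) by (rule permutes_compose)
      show "(\<sigma> \<circ> t) (2 * i + 1) = partner ((\<sigma> \<circ> t) (2 * i))" if "i < Suc d" for i
        using that Suc.prems(2)[of i] p by (cases "i = d") (auto simp: ti td)
      show "even ((\<sigma> \<circ> t) (2 * d))" using False p by (simp add: td)
    qed
    moreover have "sign (\<sigma> \<circ> t) = - sign \<sigma>"
      using tp Suc.prems(1)
      by (subst sign_compose) (auto simp: permutation_permutes t_def sign_swap_id)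
    ultimately show ?thesis using False p by (simp add: ti td parity_sign_def)
  qed
qed

text \<open>Only permutations that send pairs to pairs contribute, and each contributes
  \<open>c ^ d\<close>, because its sign cancels against the signs of the form. There are
  \<open>2 ^ d * fact d\<close> of them, but their number is left as a cardinality, since its
  positivity is what the density requires.\<close>

lemma wedge_power_darboux:
  assumes "\<And>a b. a < 2 * d \<Longrightarrow> b < 2 * d \<Longrightarrow>
    \<omega> (v a) (v b) = c * (if b = partner a then of_int (parity_sign a) else 0)"
  shows "wedge_power \<omega> d v =
    (c / 2) ^ d * card {\<sigma>. \<sigma> permutes {..<2 * d} \<and> (\<forall>i<d. \<sigma> (2 * i + 1) = partner (\<sigma> (2 * i)))}"
proof -
  let ?G = "{\<sigma>. \<sigma> permutes {..<2 * d} \<and> (\<forall>i<d. \<sigma> (2 * i + 1) = partner (\<sigma> (2 * i)))}"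
  let ?A = "{\<sigma>. \<sigma> permutes {..<2 * d}}"
  let ?t = "\<lambda>\<sigma>. of_int (sign \<sigma>) * (\<Prod>i<d. \<omega> (v (\<sigma> (2 * i))) (v (\<sigma> (2 * i + 1)))) :: real"
  have "?t \<sigma> = (if \<sigma> \<in> ?G then c ^ d else 0)" if "\<sigma> \<in> ?A" for \<sigma>
  proof -
    have "\<sigma> k < 2 * d" if "k < 2 * d" for k
      using permutes_in_image[of \<sigma> "{..<2 * d}" k] \<open>\<sigma> \<in> ?A\<close> that by simp
    then have eq: "?t \<sigma> = of_int (sign \<sigma>) * (\<Prod>i<d. c * (if \<sigma> (2 * i + 1) = partner (\<sigma> (2 * i))
        then of_int (parity_sign (\<sigma> (2 * i))) else 0))"
      using assms by (intro arg_cong2[of _ _ _ _ "(*)"] prod.cong) auto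
    show ?thesis
    proof (cases "\<sigma> \<in> ?G")
      case True
      then have "?t \<sigma> = c ^ d * of_int (sign \<sigma> * (\<Prod>i<d. parity_sign (\<sigma> (2 * i))))"
        unfolding eq by (simp add: prod.distrib)
      moreover have "sign \<sigma> * (\<Prod>i<d. parity_sign (\<sigma> (2 * i))) = 1"
        using True by (intro sign_pair_permutation) auto
      ultimately show ?thesis using True by simp
    next
      case False
      then obtain i where "i < d" "\<sigma> (2 * i + 1) \<noteq> partner (\<sigma> (2 * i))" using \<open>\<sigma> \<in> ?A\<close> by auto
      then have "(\<Prod>i<d. c * (if \<sigma> (2 * i + 1) = partner (\<sigma> (2 * i))
        then of_int (parity_sign (\<sigma> (2 * i))) else 0)) = 0"
        by (intro prod_zero) auto
      then show ?thesis unfolding eq using False by auto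
    qed
  qed
  then have "(\<Sum>\<sigma>\<in>?A. ?t \<sigma>) = (\<Sum>\<sigma>\<in>?A. if \<sigma> \<in> ?G then c ^ d else 0)"
    by (rule sum.cong[OF refl])
  also have "\<dots> = c ^ d * card ?G"
    by (subst sum.inter_restrict[symmetric]) (auto simp: finite_permutations Int_def)
  finally show ?thesis by (simp add: wedge_power_def power_divide)
qed

lemma card_pair_permutations_pos:
  "card {\<sigma>. \<sigma> permutes {..<2 * d} \<and> (\<forall>i<d. \<sigma> (2 * i + 1) = partner (\<sigma> (2 * i)))} > 0"
proof -
  have "id \<in> {\<sigma>. \<sigma> permutes {..<2 * d} \<and> (\<forall>i<d. \<sigma> (2 * i + 1) = partner (\<sigma> (2 * i)))}"
    by (auto simp: permutes_id partner_def)
  moreover have "finite {\<sigma>. \<sigma> permutes {..<2 * d} \<and> (\<forall>i<d. \<sigma> (2 * i + 1) = partner (\<sigma> (2 * i)))}"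
    by (rule finite_subset[OF _ finite_permutations[of "{..<2 * d}"]]) auto
  ultimately show ?thesis unfolding card_gt_0_iff by blast
qed

section \<open>The nilpotent matrix and its tangent frames\<close>

abbreviation Id_mat :: "real^'n^'n" where "Id_mat \<equiv> Finite_Cartesian_Product.mat 1"

text \<open>Cyclicity of the trace writes the value once through \<open>X\<close> and
  \<open>w\<close> and once through \<open>v\<close> and \<open>Y\<close>. Hence the representatives
  can be replaced one after the other, which gives the uniqueness required by \<open>THE\<close> and
  a formula that uses a representative of \<open>w\<close> alone.\<close>

lemma kks_form_eq:
  fixes y :: "real^'n^'n"
  assumes "y \<in> sl" "X \<in> sl" "Y \<in> sl" "v = lie_bracket X y" "w = lie_bracket Y y"
  shows "kks_form y v w = - (2 * CARD('n) * trace (v ** Y))"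
proof -
  let ?c = "2 * real CARD('n)"
  have kill: "killing y (lie_bracket X' Y') = ?c * trace (y ** lie_bracket X' Y')" for X' Y' :: "real^'n^'n"
    using assms(1) by (simp add: killing_eq sl_def)
  have *: "trace (y ** lie_bracket X' Y') = - trace (lie_bracket X' y ** Y')"
    "trace (y ** lie_bracket X' Y') = trace (X' ** lie_bracket Y' y)" for X' Y' :: "real^'n^'n"
    using trace_mul_sym[of y "X' ** Y'"] trace_mul_sym[of y "Y' ** X'"] trace_mul_sym[of "X' ** y" Y']
      trace_mul_sym[of "y ** Y'" X']
    by (simp_all add: lie_bracket_def matrix_algebra trace_sub)
  have uniq: "r = - (?c * trace (v ** Y))"
    if "\<exists>X'\<in>sl. \<exists>Y'\<in>sl. v = lie_bracket X' y \<and> w = lie_bracket Y' y \<and> r = killing y (lie_bracket X' Y')" for r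
  proof -
    from that obtain X' Y' where "v = lie_bracket X' y" "w = lie_bracket Y' y"
      "r = killing y (lie_bracket X' Y')" by blast
    then have "r = ?c * trace (X' ** lie_bracket Y y)"
      unfolding kill using assms(5) by (simp add: *(2))
    also have "\<dots> = - (?c * trace (v ** Y))"
      using \<open>v = lie_bracket X' y\<close> *[of X' Y] by simp
    finally show ?thesis .
  qed
  have "- (?c * trace (v ** Y)) = killing y (lie_bracket X Y)"
    unfolding kill using assms by (simp add: *(1))
  then have "\<exists>X'\<in>sl. \<exists>Y'\<in>sl. v = lie_bracket X' y \<and> w = lie_bracket Y' y
      \<and> - (?c * trace (v ** Y)) = killing y (lie_bracket X' Y')"
    using assms by (intro bexI[of _ X] bexI[of _ Y] conjI)
  then show ?thesis
    unfolding kks_form_def of_nat_mult of_nat_numeral using uniq by (rule the_equality)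
qed

text \<open>\<open>1 + C\<close> is the square of \<open>1 + C / 2\<close>.\<close>

lemma det_unipotent:
  assumes "C ** C = (0 :: real^'n^'n)"
  shows "Determinants.det (Id_mat + C) > 0"
proof -
  have "(Id_mat + (1 / 2) *\<^sub>R C) ** (Id_mat + (1 / 2) *\<^sub>R C) = Id_mat + C"
    using assms by (simp add: matrix_algebra flip: scaleR_add_left)
  then have "Determinants.det (Id_mat + C) = (Determinants.det (Id_mat + (1 / 2) *\<^sub>R C))\<^sup>2"
    by (metis det_mul power2_eq_square)
  moreover have "(Id_mat + C) ** (Id_mat - C) = Id_mat"
    using assms by (simp add: matrix_algebra)
  then have "Determinants.det (Id_mat + C) * Determinants.det (Id_mat - C) = 1"
    by (metis det_mul det_I)
  ultimately show ?thesis
    by (metis mult_zero_left zero_less_power2 zero_neq_one power_zero_numeral)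
qed

section \<open>Block structure on the index type\<close>

locale pairing =
  fixes m :: nat and f :: "nat \<Rightarrow> 'n::finite"
  assumes card_n: "CARD('n) = 2 * m" and m_gt_1: "m > 1"
    and bij_f: "bij_betw f {..<2 * m} UNIV"
begin

definition idx :: "'n \<Rightarrow> nat" where "idx i = inv_into {..<2 * m} f i"

text \<open>Even positions index the first half of the block form and odd positions the second;
  \<open>s\<close> exchanges the two members of each pair of neighbours, which is one Jordan block
  of \<open>J\<close>.\<close>

definition P :: "'n set" where "P = {i. even (idx i)}"

definition s :: "'n \<Rightarrow> 'n" where "s i = f (partner (idx i))"

lemma f_idx [simp]: "f (idx i) = i"
  unfolding idx_def using bij_f by (simp add: bij_betw_inv_into_right)

lemma idx_f [simp]: "k < 2 * m \<Longrightarrow> idx (f k) = k"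
  unfolding idx_def using bij_f by (simp add: bij_betw_inv_into_left)

lemma idx_less: "idx i < 2 * m"
  using bij_betwE[OF bij_betw_inv_into[OF bij_f]] by (simp add: idx_def)

lemma idx_s: "idx (s i) = partner (idx i)"
  by (simp add: s_def partner_less idx_less)

lemma s_s [simp]: "s (s i) = i"
  by (simp add: s_def[of "s i"] idx_s)

lemma s_eq_iff: "s i = j \<longleftrightarrow> i = s j"
  by auto

lemma s_in_P [simp]: "s i \<in> P \<longleftrightarrow> i \<notin> P"
  by (simp add: P_def idx_s)

lemma card_P: "card P = m"
proof -
  have "bij_betw (\<lambda>k. f (2 * k)) {..<m} P"
    by (rule bij_betw_byWitness[where f' = "\<lambda>i. idx i div 2"]) (use idx_less in \<open>auto simp: P_def less_mult_imp_div_less mult.commute\<close>)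
  then show ?thesis by (simp add: bij_betw_same_card[symmetric])
qed

lemma card_compl_P: "card (- P) = m"
  by (simp add: Compl_eq_Diff_UNIV card_Diff_subset card_P card_n)

text \<open>One enumeration serves both off-diagonal blocks: position \<open>(p k, q k)\<close>
  belongs to \<open>B\<close> and the transposed position to \<open>C\<close>. These two entries
  will be conjugate coordinates.\<close>

definition pair_enum :: "nat \<Rightarrow> 'n \<times> 'n" where
  "pair_enum = (SOME h. bij_betw h {..<m * m} (P \<times> - P))"

lemma bij_pair_enum: "bij_betw pair_enum {..<m * m} (P \<times> - P)"
proof -
  have "\<exists>h. bij_betw h {0..<card (P \<times> - P)} (P \<times> - P)"
    by (rule ex_bij_betw_nat_finite) simp
  then have "\<exists>h. bij_betw h {..<m * m} (P \<times> - P)"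
    by (simp add: card_P card_compl_P card_cartesian_product lessThan_atLeast0)
  then show ?thesis unfolding pair_enum_def by (rule someI_ex)
qed

definition p :: "nat \<Rightarrow> 'n" where "p k = fst (pair_enum k)"
definition q :: "nat \<Rightarrow> 'n" where "q k = snd (pair_enum k)"

lemma p_in: "k < m * m \<Longrightarrow> p k \<in> P" and q_in: "k < m * m \<Longrightarrow> q k \<notin> P"
  using bij_betwE[OF bij_pair_enum] by (auto simp: p_def q_def mem_Times_iff)

lemma pq_inj: "k < m * m \<Longrightarrow> l < m * m \<Longrightarrow> p k = p l \<and> q k = q l \<longleftrightarrow> k = l"
  using bij_betw_imp_inj_on[OF bij_pair_enum] by (auto simp: p_def q_def inj_on_def prod_eq_iff)

lemma pq_surj: "i \<in> P \<Longrightarrow> j \<notin> P \<Longrightarrow> \<exists>k<m * m. p k = i \<and> q k = j"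
proof -
  assume "i \<in> P" "j \<notin> P"
  then have "(i, j) \<in> pair_enum ` {..<m * m}"
    unfolding bij_betw_imp_surj_on[OF bij_pair_enum] by simp
  then obtain k where "(i, j) = pair_enum k" "k < m * m" by auto
  then show ?thesis by (intro exI[of _ k]) (simp add: p_def q_def flip: \<open>(i, j) = _\<close>)
qed

text \<open>Not triangularity: the support is the off-diagonal block alone, so that any product of
  two such matrices vanishes.\<close>

definition upper :: "real^'n^'n \<Rightarrow> bool" where
  "upper X \<longleftrightarrow> (\<forall>i j. i \<in> P \<and> j \<notin> P \<or> X $ i $ j = 0)"

definition lower :: "real^'n^'n \<Rightarrow> bool" where
  "lower X \<longleftrightarrow> (\<forall>i j. i \<notin> P \<and> j \<in> P \<or> X $ i $ j = 0)"

lemma upperD: "upper X \<Longrightarrow> j \<in> P \<Longrightarrow> X $ i $ j = 0" "upper X \<Longrightarrow> i \<notin> P \<Longrightarrow> X $ i $ j = 0"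
  by (auto simp: upper_def)

lemma lowerD: "lower X \<Longrightarrow> j \<notin> P \<Longrightarrow> X $ i $ j = 0" "lower X \<Longrightarrow> i \<in> P \<Longrightarrow> X $ i $ j = 0"
  by (auto simp: lower_def)

lemma upper_mult_upper:
  assumes "upper X" "upper Y" shows "X ** Y = 0"
proof -
  have "X $ i $ k * Y $ k $ j = 0" for i j k
    using assms by (cases "k \<in> P") (simp_all add: upperD)
  then show ?thesis unfolding matrix_matrix_mult_def vec_eq_iff by (simp add: sum.neutral)
qed

lemma lower_mult_lower:
  assumes "lower X" "lower Y" shows "X ** Y = 0"
proof -
  have "X $ i $ k * Y $ k $ j = 0" for i j k
    using assms by (cases "k \<in> P") (simp_all add: lowerD)
  then show ?thesis unfolding matrix_matrix_mult_def vec_eq_iff by (simp add: sum.neutral)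
qed

lemma upper_munit: "i \<in> P \<Longrightarrow> j \<notin> P \<Longrightarrow> upper (munit i j)"
  by (auto simp: upper_def munit_nth)

lemma lower_munit: "i \<notin> P \<Longrightarrow> j \<in> P \<Longrightarrow> lower (munit i j)"
  by (auto simp: lower_def munit_nth)

lemma trace_upper: "upper X \<Longrightarrow> trace X = 0"
  unfolding upper_def trace_def by (intro sum.neutral) auto

lemma trace_lower: "lower X \<Longrightarrow> trace X = 0"
  unfolding lower_def trace_def by (intro sum.neutral) auto

definition J :: "real^'n^'n" where
  "J = (\<chi> i j. if i \<in> P \<and> j = s i then 1 else 0)"

text \<open>The transpose of \<open>J\<close>; \<open>J' ** J\<close> is the diagonal projection
  onto the indices outside \<open>P\<close>.\<close>

definition J' :: "real^'n^'n" where
  "J' = (\<chi> i j. if i \<notin> P \<and> j = s i then 1 else 0)"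

text \<open>In block form, \<open>frame (0 B; 0 0) = (B 0; 0 1)\<close>.\<close>

definition frame :: "real^'n^'n \<Rightarrow> real^'n^'n" where
  "frame X = (\<chi> i j. if j \<in> P then X $ i $ s j else if i = j then 1 else 0)"

lemma mult_J_nth: "(X ** J) $ i $ j = (if j \<in> P then 0 else X $ i $ s j)"
proof -
  have "X $ i $ k * J $ k $ j = (if k = s j then (if j \<in> P then 0 else X $ i $ s j) else 0)" for k
    by (auto simp: J_def)
  then show ?thesis by (simp add: matrix_matrix_mult_def)
qed

lemma mult_J'_nth: "(X ** J') $ i $ j = (if j \<in> P then X $ i $ s j else 0)"
proof -
  have "X $ i $ k * J' $ k $ j = (if k = s j then (if j \<in> P then X $ i $ s j else 0) else 0)" for k
    by (auto simp: J'_def)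
  then show ?thesis by (simp add: matrix_matrix_mult_def)
qed

lemma J_mult_nth: "(J ** X) $ i $ j = (if i \<in> P then X $ s i $ j else 0)"
  by (simp add: matrix_matrix_mult_def J_def if_distrib[of "\<lambda>x. x * _"] cong: if_cong)

lemma upper_J: "upper J"
  by (auto simp: upper_def J_def)

lemma J_sq: "J ** J = 0"
  by (simp add: upper_J upper_mult_upper)

lemma frame_J: "upper X \<Longrightarrow> frame X ** J = X"
  by (simp add: vec_eq_iff mult_J_nth frame_def upperD)

lemma mult_frame:
  assumes "upper X" shows "X ** frame X = X"
proof -
  have "(X ** frame X) $ i $ j = X $ i $ j" for i j
  proof -
    have "X $ i $ k * frame X $ k $ j = (if k = j then X $ i $ j else 0)" for k
      using assms by (cases "k \<in> P"; cases "j \<in> P") (auto simp: frame_def upperD)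
    then have "(X ** frame X) $ i $ j = (\<Sum>k\<in>UNIV. if k = j then X $ i $ j else 0)"
      by (simp add: matrix_matrix_mult_def)
    then show ?thesis by simp
  qed
  then show ?thesis by (simp add: vec_eq_iff)
qed

lemma upper_J'_J: "upper X \<Longrightarrow> X ** (J' ** J) = X"
  by (simp add: vec_eq_iff mult_J_nth matrix_mul_assoc mult_J'_nth upperD)

lemma unipotent_inverse:
  assumes "lower C"
  shows "(Id_mat + C) ** (Id_mat - C) = Id_mat" "(Id_mat - C) ** (Id_mat + C) = Id_mat"
  using lower_mult_lower[OF assms assms] by (simp_all add: matrix_algebra)

definition phi :: "real^'n^'n \<Rightarrow> real^'n^'n \<Rightarrow> real^'n^'n" where
  "phi X C = (Id_mat + C) ** X ** (Id_mat - C)"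

text \<open>Since \<open>X ** frame X = X = frame X ** J\<close>, the matrix \<open>frame X\<close>
  intertwines \<open>X\<close> and \<open>J\<close>; conjugation by the unipotent factor carries
  this over to \<open>phi X C\<close>. The sign of \<open>det (frame X)\<close> therefore decides in
  which orbit the point lies.\<close>

lemma phi_frame:
  assumes "upper X" "lower C"
  shows "phi X C ** ((Id_mat + C) ** frame X) = ((Id_mat + C) ** frame X) ** J"
proof -
  have "phi X C ** ((Id_mat + C) ** frame X) = (Id_mat + C) ** X ** ((Id_mat - C) ** (Id_mat + C)) ** frame X"
    unfolding phi_def by (simp only: matrix_mul_assoc)
  then show ?thesis
    using assms by (simp add: unipotent_inverse matrix_mul_assoc[symmetric] mult_frame frame_J)
qed

lemma trace_conj:
  assumes "B ** A = Id_mat"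
  shows "trace (A ** X ** B) = trace (X :: real^'n^'n)"
  using assms by (metis trace_mul_sym matrix_mul_assoc matrix_mul_lid)

lemma phi_in_sl: "upper X \<Longrightarrow> lower C \<Longrightarrow> phi X C \<in> sl"
  unfolding phi_def sl_def by (simp add: trace_conj unipotent_inverse trace_upper)

text \<open>The coordinate vectors of the chart, written down before the chart: even indices vary an
  entry of \<open>B\<close>, odd ones an entry of \<open>C\<close>. In the odd case the derivative
  is a bracket, because the matrix unit and \<open>C\<close> annihilate each other.\<close>

definition tvec :: "real^'n^'n \<Rightarrow> real^'n^'n \<Rightarrow> nat \<Rightarrow> real^'n^'n" where
  "tvec X C a = (if even a then (Id_mat + C) ** munit (p (a div 2)) (q (a div 2)) ** (Id_mat - C)
     else lie_bracket (munit (q (a div 2)) (p (a div 2))) (phi X C))"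

text \<open>Directions in the block \<open>B\<close> are tangent to the orbit, and their
  representatives pair to zero with all such directions: these directions span an isotropic
  subspace.\<close>

lemma upper_tangent:
  assumes X: "upper X" and C: "lower C" and E: "upper E" and det: "Determinants.det (frame X) \<noteq> 0"
  shows "\<exists>Y\<in>sl. (Id_mat + C) ** E ** (Id_mat - C) = lie_bracket Y (phi X C) \<and>
    (\<forall>E'. upper E' \<longrightarrow> trace ((Id_mat + C) ** E' ** (Id_mat - C) ** Y) = 0)"
proof -
  let ?L = "Id_mat + C" and ?K = "Id_mat - C"
  from det obtain h where h: "h ** frame X = Id_mat"
    by (metis invertible_det_nz invertible_def)
  \<comment> \<open>In block form \<open>Z = (E B^-1 0; 0 0)\<close>, which solves
    \<open>Z ** X = E\<close> while \<open>E' ** Z = 0\<close> for every \<open>E'\<close> in the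
    upper block.\<close>
  define Z where "Z = E ** J' ** h"
  define t where "t = trace (?L ** Z ** ?K) / CARD('n)"
  \<comment> \<open>Subtracting a multiple of the identity makes the trace 0 and does not affect
    brackets.\<close>
  define Y where "Y = ?L ** Z ** ?K - t *\<^sub>R Id_mat"
  have KL: "?K ** ?L = Id_mat" using C by (rule unipotent_inverse)
  have "Z ** X = E ** J' ** (h ** frame X) ** J"
    unfolding Z_def by (metis X frame_J matrix_mul_assoc)
  then have ZX: "Z ** X = E"
    using E by (simp add: h upper_J'_J matrix_mul_assoc[symmetric])
  have XZ: "E' ** Z = 0" if "upper E'" for E'
    unfolding Z_def using upper_mult_upper[OF that E] by (simp add: matrix_mul_assoc)
  have "Y \<in> sl" by (simp add: Y_def t_def sl_def trace_sub trace_scaleR trace_mat_1)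
  moreover have conj: "(?L ** A ** ?K) ** (?L ** B ** ?K) = ?L ** (A ** B) ** ?K" for A B
  proof -
    have "(?L ** A ** ?K) ** (?L ** B ** ?K) = ?L ** A ** (?K ** ?L) ** B ** ?K"
      by (simp only: matrix_mul_assoc)
    then show ?thesis by (simp add: KL matrix_mul_assoc)
  qed
  have "lie_bracket (A - t *\<^sub>R Id_mat) B = A ** B - B ** A" for A B :: "real^'n^'n"
    by (simp add: lie_bracket_def matrix_algebra)
  then have "lie_bracket Y (phi X C) = (?L ** Z ** ?K) ** (?L ** X ** ?K) - (?L ** X ** ?K) ** (?L ** Z ** ?K)"
    unfolding Y_def phi_def .
  then have "?L ** E ** ?K = lie_bracket Y (phi X C)"
    by (simp only: conj ZX XZ[OF X]) simp
  moreover have "trace (?L ** E' ** ?K ** Y) = 0" if "upper E'" for E'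
  proof -
    have "?L ** E' ** ?K ** Y = ?L ** (E' ** Z) ** ?K - t *\<^sub>R (?L ** E' ** ?K)"
    proof -
      have "A ** (B - t *\<^sub>R Id_mat) = A ** B - t *\<^sub>R A" for A B :: "real^'n^'n"
        by (simp add: matrix_algebra)
      then show ?thesis unfolding Y_def conj[symmetric] .
    qed
    then have "trace (?L ** E' ** ?K ** Y) = trace (E' ** Z) - t * trace E'"
      by (simp only: trace_sub trace_scaleR trace_conj[OF KL])
    then show ?thesis using XZ[OF that] that by (simp add: trace_zero trace_upper)
  qed
  ultimately show ?thesis by blast
qed

text \<open>A single table of traces yields tangency, linear independence and the Darboux property.
  Its two diagonal parts vanish, by \<open>upper_tangent\<close> and because matrices in the lower
  block multiply to zero; the mixed part is the duality between matrix units and their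
  transposes.\<close>

lemma tvec_dual:
  assumes X: "upper X" and C: "lower C" and det: "Determinants.det (frame X) \<noteq> 0"
  shows "\<exists>Y. \<forall>a<2 * (m * m). Y a \<in> sl \<and> tvec X C a = lie_bracket (Y a) (phi X C) \<and>
    (\<forall>b<2 * (m * m). trace (tvec X C b ** Y a) = (if a = partner b then of_int (parity_sign b) else 0))"
proof -
  let ?E = "\<lambda>a. munit (p (a div 2)) (q (a div 2)) :: real^'n^'n"
    and ?F = "\<lambda>a. munit (q (a div 2)) (p (a div 2)) :: real^'n^'n"
  have U: "upper (?E a)" and L: "lower (?F a)" if "a < 2 * (m * m)" for a
    using that by (auto intro!: upper_munit lower_munit p_in q_in)
  have "\<exists>Y\<in>sl. (Id_mat + C) ** ?E a ** (Id_mat - C) = lie_bracket Y (phi X C) \<and>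
    (\<forall>E'. upper E' \<longrightarrow> trace ((Id_mat + C) ** E' ** (Id_mat - C) ** Y) = 0)" if "a < 2 * (m * m)" for a
    using upper_tangent[OF X C U[OF that] det] .
  then obtain Z where Z: "\<And>a. a < 2 * (m * m) \<Longrightarrow> Z a \<in> sl"
    "\<And>a. a < 2 * (m * m) \<Longrightarrow> (Id_mat + C) ** ?E a ** (Id_mat - C) = lie_bracket (Z a) (phi X C)"
    "\<And>a E'. a < 2 * (m * m) \<Longrightarrow> upper E' \<Longrightarrow> trace ((Id_mat + C) ** E' ** (Id_mat - C) ** Z a) = 0"
    by metis
  define Y where "Y a = (if even a then Z a else ?F a)" for a
  \<comment> \<open>Moving \<open>1 + C\<close> around the trace conjugates \<open>?F a\<close>,
    which is unchanged because its products with \<open>C\<close> on both sides are zero.\<close>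
  have EF: "trace ((Id_mat + C) ** ?E b ** (Id_mat - C) ** ?F a) = (if a div 2 = b div 2 then 1 else 0)"
    if "a < 2 * (m * m)" "b < 2 * (m * m)" for a b
  proof -
    have "trace ((Id_mat + C) ** ?E b ** (Id_mat - C) ** ?F a) = trace (?E b ** ((Id_mat - C) ** ?F a ** (Id_mat + C)))"
      using trace_mul_sym[of "Id_mat + C" "?E b ** (Id_mat - C) ** ?F a"] by (simp add: matrix_mul_assoc)
    also have "(Id_mat - C) ** ?F a ** (Id_mat + C) = ?F a"
      using lower_mult_lower[OF C L[OF that(1)]] lower_mult_lower[OF L[OF that(1)] C]
      by (simp add: matrix_algebra)
    also have "trace (?E b ** ?F a) = (if a div 2 = b div 2 then 1 else 0)"
      using pq_inj[of "a div 2" "b div 2"] that by (auto simp: munit_mult_munit trace_munit trace_zero)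
    finally show ?thesis .
  qed
  \<comment> \<open>This antisymmetry turns the pairing of an odd vector with an even representative
    into the one already computed.\<close>
  have swap: "trace (lie_bracket A y ** B) = - trace (lie_bracket B y ** A)" for A B y :: "real^'n^'n"
    using trace_mul_sym[of A "y ** B"] trace_mul_sym[of B "A ** y"] trace_mul_sym[of y "A ** B"]
      trace_mul_sym[of y "B ** A"] trace_mul_sym[of B "y ** A"]
    by (simp add: lie_bracket_def matrix_algebra trace_sub)
  have "trace (tvec X C b ** Y a) = (if a = partner b then of_int (parity_sign b) else 0)"
    if "a < 2 * (m * m)" "b < 2 * (m * m)" for a b
  proof -
    consider "even a" "even b" | "odd a" "even b" | "even a" "odd b" | "odd a" "odd b" by blast
    then show ?thesis
    proof cases
      case 1
      then show ?thesis using Z(3)[of a "?E b"] U that by (auto simp: tvec_def Y_def partner_def)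
    next
      case 2
      then have "a div 2 = b div 2 \<longleftrightarrow> a = partner b" by (auto simp: partner_def elim!: oddE evenE)
      then show ?thesis using 2 EF[of a b] that by (simp add: tvec_def Y_def parity_sign_def)
    next
      case 3
      then have "b div 2 = a div 2 \<longleftrightarrow> a = partner b" by (auto simp: partner_def elim!: oddE evenE)
      then show ?thesis
        using 3 EF[of b a] that Z(2)[of a] swap[of "?F b" "phi X C" "Z a"]
        by (simp add: tvec_def Y_def parity_sign_def)
    next
      case 4
      then have "trace (lie_bracket (?F b) (phi X C) ** ?F a) =
        trace (?F b ** phi X C ** ?F a) - trace (phi X C ** (?F b ** ?F a))"
        by (simp add: lie_bracket_def matrix_mul_diff_left trace_sub matrix_mul_assoc)
      also have "trace (?F b ** phi X C ** ?F a) = trace (phi X C ** (?F a ** ?F b))"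
        using trace_mul_sym[of "?F b" "phi X C ** ?F a"] by (simp add: matrix_mul_assoc)
      finally show ?thesis
        using 4 lower_mult_lower[OF L[OF that(1)] L[OF that(2)]] lower_mult_lower[OF L[OF that(2)] L[OF that(1)]]
        by (auto simp: tvec_def Y_def trace_zero partner_def)
    qed
  qed
  moreover have "Y a \<in> sl" if "a < 2 * (m * m)" for a
    using Z(1)[OF that] trace_lower[OF L[OF that]] by (simp add: Y_def sl_def)
  moreover have "tvec X C a = lie_bracket (Y a) (phi X C)" if "a < 2 * (m * m)" for a
    using Z(2)[OF that] by (simp add: tvec_def Y_def)
  ultimately show ?thesis by blast
qed

text \<open>The trace against the representative with index \<open>partner b\<close> kills every
  term except the one with coefficient \<open>c b\<close>.\<close>

lemma tvec_independent:
  assumes "upper X" "lower C" "Determinants.det (frame X) \<noteq> 0"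
    and sum: "(\<Sum>a<2 * (m * m). c a *\<^sub>R tvec X C a) = 0" and "b < 2 * (m * m)"
  shows "c b = 0"
proof -
  obtain Y where Y: "\<And>a b. a < 2 * (m * m) \<Longrightarrow> b < 2 * (m * m) \<Longrightarrow>
    trace (tvec X C b ** Y a) = (if a = partner b then of_int (parity_sign b) else 0)"
    using tvec_dual[OF assms(1-3)] by metis
  have pb: "partner b < 2 * (m * m)" using partner_less assms(5) by blast
  have lin: "linear (\<lambda>Z. trace (Z ** Y (partner b)))"
    by (rule linearI) (simp_all add: matrix_add_rdistrib trace_add matrix_mul_scaleR_left trace_scaleR)
  have "0 = trace ((\<Sum>a<2 * (m * m). c a *\<^sub>R tvec X C a) ** Y (partner b))"
    by (simp add: sum trace_zero)
  also have "\<dots> = (\<Sum>a<2 * (m * m). c a * trace (tvec X C a ** Y (partner b)))"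
    by (simp add: linear_sum[OF lin] linear_scale[OF lin])
  also have "\<dots> = (\<Sum>a<2 * (m * m). if a = b then c b * of_int (parity_sign b) else 0)"
    by (intro sum.cong refl) (auto simp: Y pb, metis partner_partner)
  finally show ?thesis using assms(5) by (simp add: parity_sign_def split: if_splits)
qed

text \<open>The factor \<open>4 * m\<close> is \<open>2 * CARD('n)\<close> from the Killing form,
  and the minus sign is that of \<open>kks_form_eq\<close>.\<close>

lemma kks_tvec:
  assumes "upper X" "lower C" "Determinants.det (frame X) \<noteq> 0" "a < 2 * (m * m)" "b < 2 * (m * m)"
  shows "kks_form (phi X C) (tvec X C a) (tvec X C b) =
    - (4 * real m) * (if b = partner a then of_int (parity_sign a) else 0)"
proof -
  obtain Y where Y: "\<And>a. a < 2 * (m * m) \<Longrightarrow> Y a \<in> sl \<and> tvec X C a = lie_bracket (Y a) (phi X C)"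
    "\<And>a b. a < 2 * (m * m) \<Longrightarrow> b < 2 * (m * m) \<Longrightarrow>
    trace (tvec X C b ** Y a) = (if a = partner b then of_int (parity_sign b) else 0)"
    using tvec_dual[OF assms(1-3)] by metis
  show ?thesis
    using kks_form_eq[OF phi_in_sl[OF assms(1,2)], of "Y a" "Y b"] Y assms(4,5) by (simp add: card_n)
qed

end

section \<open>The two orbits\<close>

lemma invertible_obtain_inverse:
  fixes g :: "real^'n^'n"
  assumes "Determinants.det g \<noteq> 0"
  obtains h where "g ** h = Id_mat" "h ** g = Id_mat"
  using assms invertible_det_nz[of g] unfolding invertible_def by blast

lemma matrix_inv_mult:
  fixes g :: "real^'n^'n"
  assumes "Determinants.det g \<noteq> 0"
  shows "g ** matrix_inv g = Id_mat" "matrix_inv g ** g = Id_mat"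
proof -
  have "\<exists>h. g ** h = Id_mat \<and> h ** g = Id_mat" using assms invertible_obtain_inverse by metis
  then show "g ** matrix_inv g = Id_mat" "matrix_inv g ** g = Id_mat"
    unfolding matrix_inv_def by (metis (mono_tags, lifting) someI_ex)+
qed

lemma det_scaleR: "Determinants.det (c *\<^sub>R g) = c ^ CARD('n) * Determinants.det (g :: real^'n^'n)"
proof -
  have "Determinants.det (c *\<^sub>R Id_mat :: real^'n^'n) = c ^ CARD('n)"
    by (subst det_diagonal) (simp_all add: mat_def)
  then show ?thesis
    by (metis det_mul matrix_mul_lid matrix_mul_scaleR_left)
qed

text \<open>A matrix of positive determinant can be rescaled to determinant 1.\<close>

lemma adjoint_orbit_eq:
  "adjoint_orbit x = {y :: real^'n^'n. \<exists>g. Determinants.det g > 0 \<and> y ** g = g ** x}"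
proof (intro equalityI subsetI)
  fix y assume "y \<in> adjoint_orbit x"
  then obtain g where g: "y = g ** x ** matrix_inv g" "Determinants.det g = 1"
    by (auto simp: adjoint_orbit_def)
  then have "y ** g = g ** x"
    using matrix_inv_mult[of g] by (simp add: matrix_mul_assoc[symmetric])
  then show "y \<in> {y. \<exists>g. Determinants.det g > 0 \<and> y ** g = g ** x}" using g by force
next
  fix y assume "y \<in> {y. \<exists>g. Determinants.det g > 0 \<and> y ** g = g ** x}"
  then obtain g where g: "Determinants.det g > 0" "y ** g = g ** x" by blast
  define c where "c = root CARD('n) (1 / Determinants.det g)"
  have det: "Determinants.det (c *\<^sub>R g) = 1"
    using g(1) by (simp add: det_scaleR c_def)
  have "y ** (c *\<^sub>R g) = (c *\<^sub>R g) ** x"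
    using g by (simp add: matrix_mul_scaleR_left matrix_mul_scaleR_right)
  then have "y = (c *\<^sub>R g) ** x ** matrix_inv (c *\<^sub>R g)"
    using matrix_inv_mult[of "c *\<^sub>R g"] det by (metis matrix_mul_assoc matrix_mul_rid zero_neq_one)
  with det show "y \<in> adjoint_orbit x" unfolding adjoint_orbit_def by blast
qed

lemma dim_orbit_tangent_conj_le:
  fixes x y g h :: "real^'n^'n"
  assumes gh: "g ** h = Id_mat" "h ** g = Id_mat" and y: "y ** g = g ** x"
  shows "dim (orbit_tangent x) \<le> dim (orbit_tangent y)"
proof -
  let ?c = "\<lambda>A. g ** A ** h"
  have mult: "?c (A ** B) = ?c A ** ?c B" for A B
  proof -
    have "?c A ** ?c B = g ** A ** (h ** g) ** B ** h" by (simp only: matrix_mul_assoc)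
    then show ?thesis by (simp add: gh matrix_mul_assoc)
  qed
  have lin: "linear ?c"
    by (rule linearI) (simp_all add: matrix_algebra)
  have "A = B" if "?c A = ?c B" for A B
  proof -
    have "h ** ?c A ** g = A" for A
    proof -
      have "h ** ?c A ** g = (h ** g) ** A ** (h ** g)" by (simp only: matrix_mul_assoc)
      then show ?thesis by (simp add: gh)
    qed
    then show ?thesis using that by metis
  qed
  then have inj: "inj ?c" by (rule injI)
  have y_eq: "y = ?c x" using y gh by (metis matrix_mul_assoc matrix_mul_rid)
  have "?c ` orbit_tangent x \<subseteq> orbit_tangent y"
  proof (clarsimp simp: orbit_tangent_def)
    fix X :: "real^'n^'n" assume "X \<in> sl"
    have "trace (?c X) = trace X" using trace_mul_sym[of g "X ** h"] gh
      by (metis matrix_mul_assoc matrix_mul_rid)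
    moreover have "?c (lie_bracket X x) = lie_bracket (?c X) y"
      unfolding lie_bracket_def y_eq mult[symmetric]
      by (simp only: matrix_mul_diff_left matrix_mul_diff_right)
    ultimately show "?c (lie_bracket X x) \<in> (\<lambda>X. lie_bracket X y) ` sl"
      using \<open>X \<in> sl\<close> by (simp add: sl_def)
  qed
  then have "dim (?c ` orbit_tangent x) \<le> dim (orbit_tangent y)" by (rule dim_subset)
  then show ?thesis using dim_image_eq[OF lin, of "orbit_tangent x"] inj
    by (simp add: inj_on_subset)
qed

text \<open>Conjugation embeds one tangent space into the other, and the inverse gives the reverse
  inequality. As \<open>g\<close> may have either sign of determinant, the point \<open>J\<close>
  determines the dimension on both orbits.\<close>

lemma dim_orbit_tangent_conj:
  fixes x y g :: "real^'n^'n"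
  assumes "Determinants.det g \<noteq> 0" and y: "y ** g = g ** x"
  shows "dim (orbit_tangent y) = dim (orbit_tangent x)"
proof -
  obtain h where gh: "g ** h = Id_mat" "h ** g = Id_mat" using assms(1) by (rule invertible_obtain_inverse)
  have "x ** h = h ** y"
  proof -
    have "x ** h = h ** (g ** x) ** h" by (simp add: gh matrix_mul_assoc)
    also have "\<dots> = h ** y ** (g ** h)" by (simp only: y[symmetric] matrix_mul_assoc)
    finally show ?thesis by (simp add: gh)
  qed
  then show ?thesis
    using dim_orbit_tangent_conj_le[OF gh y] dim_orbit_tangent_conj_le[OF gh(2,1), of x y] by simp
qed

lemma matrix_eq_sum_munit: "X = (\<Sum>i\<in>UNIV. \<Sum>j\<in>UNIV. X $ i $ j *\<^sub>R (munit i j :: real^'n^'n))"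
proof -
  have "(\<Sum>e\<in>Basis. (X \<bullet> e) *\<^sub>R e) = X" by (rule euclidean_representation)
  moreover have "X \<bullet> munit i j = X $ i $ j" for i j
  proof -
    have "munit i j = (axis i (axis j 1) :: real^'n^'n)" by (auto simp: vec_eq_iff axis_def munit_nth)
    then show ?thesis by (simp add: inner_axis)
  qed
  ultimately show ?thesis by (simp add: sum_Basis_matrix)
qed

context pairing
begin

section \<open>Dimension of the orbits\<close>

lemma s_neq: "s i \<noteq> i"
  by (metis s_in_P)

lemma frame_J_eq: "frame J = Id_mat"
  by (auto simp: vec_eq_iff frame_def J_def Finite_Cartesian_Product.mat_def s_eq_iff)

lemma lower_0 [simp]: "lower 0"
  by (simp add: lower_def)

lemma phi_0 [simp]: "phi X 0 = X"
  by (simp add: phi_def)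

text \<open>The upper bound for the tangent space at \<open>J\<close>, complementing
  \<open>tvec_independent\<close>. Bracketing with \<open>J\<close> sends a unit of a diagonal block
  to a unit of the upper block up to sign, a unit of the upper block to 0, and a unit of the lower
  block to an odd frame vector.\<close>

lemma lie_bracket_J_in_span: "lie_bracket Z J \<in> span (tvec J 0 ` {..<2 * (m * m)})"
proof -
  let ?S = "span (tvec J 0 ` {..<2 * (m * m)})"
  have up: "munit i j \<in> ?S" if "i \<in> P" "j \<notin> P" for i j
  proof -
    obtain k where "k < m * m" "p k = i" "q k = j" using pq_surj \<open>i \<in> P\<close> \<open>j \<notin> P\<close> by blast
    then have "munit i j = tvec J 0 (2 * k)" "2 * k < 2 * (m * m)" by (simp_all add: tvec_def)
    then show ?thesis by (auto intro: span_base)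
  qed
  have "lie_bracket (munit i j) J \<in> ?S" for i j
  proof (cases "i \<in> P"; cases "j \<in> P")
    assume "i \<in> P" "j \<in> P"
    then have "lie_bracket (munit i j) J = munit i (s j)"
      using s_neq[of j] by (auto simp: lie_bracket_def vec_eq_iff mult_J_nth J_mult_nth munit_nth s_eq_iff)
    then show ?thesis using up \<open>i \<in> P\<close> \<open>j \<in> P\<close> by simp
  next
    assume "i \<in> P" "j \<notin> P"
    then have "lie_bracket (munit i j) J = 0"
      by (simp add: lie_bracket_def upper_mult_upper upper_J upper_munit)
    then show ?thesis by (simp add: span_zero)
  next
    assume ij: "i \<notin> P" "j \<in> P"
    then obtain k where "k < m * m" "p k = j" "q k = i" using pq_surj by blast
    then have "lie_bracket (munit i j) J = tvec J 0 (2 * k + 1)" "2 * k + 1 < 2 * (m * m)"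
      by (simp_all add: tvec_def)
    then show ?thesis by (auto intro: span_base)
  next
    assume "i \<notin> P" "j \<notin> P"
    then have "lie_bracket (munit i j) J = - munit (s i) j"
      using s_neq[of i] by (auto simp: lie_bracket_def vec_eq_iff mult_J_nth J_mult_nth munit_nth s_eq_iff)
    then show ?thesis using up \<open>i \<notin> P\<close> \<open>j \<notin> P\<close> by (simp add: span_neg)
  qed
  moreover have lin: "linear (\<lambda>Z. lie_bracket Z J)"
    by (rule linearI) (simp_all add: lie_bracket_def matrix_algebra algebra_simps)
  have "lie_bracket Z J = (\<Sum>i\<in>UNIV. \<Sum>j\<in>UNIV. Z $ i $ j *\<^sub>R lie_bracket (munit i j) J)"
    by (subst matrix_eq_sum_munit[of Z]) (simp only: linear_sum[OF lin] linear_scale[OF lin])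
  ultimately show ?thesis by (simp add: span_sum span_scale)
qed

lemma dim_orbit_tangent_J: "dim (orbit_tangent J) = 2 * (m * m)"
proof -
  let ?I = "{..<2 * (m * m)}"
  let ?v = "tvec J 0"
  have indep: "c b = 0" if "(\<Sum>a\<in>?I. c a *\<^sub>R ?v a) = 0" "b \<in> ?I" for c b
    using tvec_independent[OF upper_J lower_0 _ that(1)] that(2) by (simp add: frame_J_eq)
  have inj: "inj_on ?v ?I"
  proof (rule inj_onI, rule ccontr)
    fix a b assume ab: "a \<in> ?I" "b \<in> ?I" "?v a = ?v b" "a \<noteq> b"
    \<comment> \<open>Independence of the indexed family also excludes repetitions: equal vectors
      would satisfy the relation with coefficients 1 and -1.\<close>
    define c :: "nat \<Rightarrow> real" where "c i = (if i = a then 1 else if i = b then - 1 else 0)" for i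
    have "(\<Sum>i\<in>?I. c i *\<^sub>R ?v i) = (\<Sum>i\<in>?I. (if i = a then ?v a else 0) - (if i = b then ?v b else 0))"
      using ab(4) by (intro sum.cong) (auto simp: c_def)
    also have "\<dots> = 0" using ab by (simp add: sum_subtractf)
    finally have "c a = 0" using ab(1) by (rule indep)
    then show False by (simp add: c_def)
  qed
  have "independent (?v ` ?I)"
  proof (rule independent_if_scalars_zero)
    fix g w assume "(\<Sum>x\<in>?v ` ?I. g x *\<^sub>R x) = 0" "w \<in> ?v ` ?I"
    then show "g w = 0" using indep[of "\<lambda>a. g (?v a)"] by (auto simp: sum.reindex[OF inj])
  qed simp
  moreover have "?v ` ?I \<subseteq> orbit_tangent J"
    using tvec_dual[OF upper_J lower_0] by (force simp: frame_J_eq orbit_tangent_def)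
  moreover have "orbit_tangent J \<subseteq> span (?v ` ?I)"
    using lie_bracket_J_in_span by (auto simp: orbit_tangent_def)
  ultimately have "dim (orbit_tangent J) = card (?v ` ?I)"
    by (intro dim_unique) auto
  then show ?thesis by (simp add: card_image[OF inj])
qed

text \<open>Only \<open>\<sigma> = 1\<close> and \<open>\<sigma> = - 1\<close> occur. The
  intertwining form avoids inverses and treats both orbits alike.\<close>

definition orb :: "real \<Rightarrow> (real^'n^'n) set" where
  "orb \<sigma> = {y. \<exists>g. \<sigma> * Determinants.det g > 0 \<and> y ** g = g ** J}"

text \<open>An involution of determinant -1. Because \<open>f 0\<close> lies in \<open>P\<close>, it
  is also the frame of \<open>refl ** J\<close>, which provides a sample block of negative
  determinant.\<close>

definition refl :: "real^'n^'n" where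
  "refl = (\<chi> i j. if i = j then if i = f 0 then - 1 else 1 else 0)"

lemma refl_sq: "refl ** refl = Id_mat"
proof -
  have "refl $ i $ k * refl $ k $ j = (if k = i then if i = j then 1 else 0 else 0)" for i j k
    by (simp add: refl_def)
  then show ?thesis
    by (simp add: vec_eq_iff matrix_matrix_mult_def Finite_Cartesian_Product.mat_def)
qed

lemma det_refl: "Determinants.det refl = - 1"
proof -
  have "Determinants.det refl = (\<Prod>i\<in>UNIV. if i = f 0 then - 1 else 1)"
    by (subst det_diagonal) (simp_all add: refl_def)
  then show ?thesis by simp
qed

lemma orb_pos: "orb 1 = adjoint_orbit J"
  by (simp add: orb_def adjoint_orbit_eq)

text \<open>If \<open>g\<close> carries \<open>J\<close> to \<open>y\<close>, then
  \<open>g ** refl\<close> carries \<open>refl ** J ** refl\<close> to \<open>y\<close>, and its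
  determinant has the opposite sign.\<close>

lemma orb_neg: "orb (- 1) = adjoint_orbit (refl ** J ** refl)"
proof -
  have "(\<exists>g. Determinants.det g < 0 \<and> y ** g = g ** J) \<longleftrightarrow>
    (\<exists>g. 0 < Determinants.det g \<and> y ** g = g ** (refl ** J ** refl))" for y
  proof
    assume "\<exists>g. Determinants.det g < 0 \<and> y ** g = g ** J"
    then obtain g where g: "Determinants.det g < 0" "y ** g = g ** J" by blast
    have "y ** (g ** refl) = (g ** (refl ** refl)) ** J ** refl"
      using g(2) by (simp add: refl_sq matrix_mul_assoc)
    then have "y ** (g ** refl) = (g ** refl) ** (refl ** J ** refl)"
      by (simp only: matrix_mul_assoc)
    then show "\<exists>g. 0 < Determinants.det g \<and> y ** g = g ** (refl ** J ** refl)"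
      using g(1) by (intro exI[of _ "g ** refl"]) (simp add: det_mul det_refl)
  next
    assume "\<exists>g. 0 < Determinants.det g \<and> y ** g = g ** (refl ** J ** refl)"
    then obtain g where g: "Determinants.det g > 0" "y ** g = g ** (refl ** J ** refl)" by blast
    have "y ** (g ** refl) = (g ** refl) ** J ** (refl ** refl)"
      using g(2) by (simp only: matrix_mul_assoc)
    then have "y ** (g ** refl) = (g ** refl) ** J" by (simp add: refl_sq)
    then show "\<exists>g. Determinants.det g < 0 \<and> y ** g = g ** J"
      using g(1) by (intro exI[of _ "g ** refl"]) (simp add: det_mul det_refl)
  qed
  then show ?thesis by (simp add: orb_def adjoint_orbit_eq)
qed

lemma J_in_sl: "J \<in> sl" "refl ** J ** refl \<in> sl"
  by (simp_all add: sl_def trace_conj refl_sq trace_upper upper_J)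

lemma orb_nonempty: "orb 1 \<noteq> {}" "orb (- 1) \<noteq> {}"
proof -
  have "J \<in> orb 1" by (auto simp: orb_def intro!: exI[of _ Id_mat])
  moreover have "refl ** J ** refl \<in> orb (- 1)"
    unfolding orb_neg adjoint_orbit_eq by (auto intro!: exI[of _ Id_mat])
  ultimately show "orb 1 \<noteq> {}" "orb (- 1) \<noteq> {}" by auto
qed

lemma orbit_dim_orb:
  assumes "\<sigma> = 1 \<or> \<sigma> = - 1"
  shows "orbit_dim (orb \<sigma>) = 2 * (m * m)"
proof -
  have "dim (orbit_tangent y) = 2 * (m * m)" if "y \<in> orb \<sigma>" for y
  proof -
    obtain g where "\<sigma> * Determinants.det g > 0" "y ** g = g ** J"
      using \<open>y \<in> orb \<sigma>\<close> by (auto simp: orb_def)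
    moreover from this have "Determinants.det g \<noteq> 0" by auto
    ultimately show ?thesis using dim_orbit_tangent_conj[of g y J] dim_orbit_tangent_J by simp
  qed
  \<comment> \<open>Without a point in the orbit the description of \<open>orbit_dim\<close> would
    hold for every number.\<close>
  moreover have "orb \<sigma> \<noteq> {}" using assms orb_nonempty by auto
  ultimately show ?thesis
    unfolding orbit_dim_def by (intro the_equality) auto
qed

lemma det_commuting_nonneg:
  assumes comm: "k ** J = J ** k"
  shows "Determinants.det k \<ge> 0"
proof -
  have ent: "(if j \<in> P then 0 else k $ i $ s j) = (if i \<in> P then k $ s i $ j else 0)" for i j
    using arg_cong[OF comm, of "\<lambda>X. X $ i $ j"] by (simp add: mult_J_nth J_mult_nth)
  have QP: "k $ i $ j = 0" if "i \<notin> P" "j \<in> P" for i j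
    using ent[of j "s i"] that by simp
  have QQ: "k $ s i $ s j = k $ i $ j" if "i \<notin> P" "j \<notin> P" for i j
    using ent[of j "s i"] that by simp
  \<comment> \<open>Padding the blocks with the identity gives the factorization
    \<open>(A B; 0 A) = (1 0; 0 A) (1 B; 0 1) (A 0; 0 1)\<close>, up to the names of the blocks. The
    two padded copies of \<open>A\<close> are conjugate under the exchange \<open>S\<close> of the
    halves, so they have equal determinants.\<close>
  define a :: "real^'n^'n" where "a = (\<chi> i j. if i \<in> P \<and> j \<in> P then k $ i $ j else if i = j then 1 else 0)"
  define b :: "real^'n^'n" where "b = (\<chi> i j. if i \<notin> P \<and> j \<notin> P then k $ i $ j else if i = j then 1 else 0)"
  define S :: "real^'n^'n" where "S = (\<chi> i j. if j = s i then 1 else 0)"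
  define B :: "real^'n^'n" where "B = (\<chi> i j. if i \<in> P \<and> j \<notin> P then k $ i $ j else 0)"
  have Sl: "(S ** X) $ i $ j = X $ s i $ j" for X i j
    by (simp add: S_def matrix_matrix_mult_def if_distrib[of "\<lambda>x. x * _"] cong: if_cong)
  have Sr: "(X ** S) $ i $ j = X $ i $ s j" for X i j
  proof -
    have "X $ i $ l * S $ l $ j = (if l = s j then X $ i $ s j else 0)" for l by (auto simp: S_def)
    then show ?thesis by (simp add: matrix_matrix_mult_def)
  qed
  have "S ** S = Id_mat"
    by (auto simp: vec_eq_iff Sl) (auto simp: S_def Finite_Cartesian_Product.mat_def)
  then have "Determinants.det S * Determinants.det S = 1" by (metis det_mul det_I)
  moreover have "b = S ** a ** S"
    by (auto simp: vec_eq_iff Sl Sr a_def b_def QQ s_eq_iff)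
  ultimately have det_b: "Determinants.det b = Determinants.det a"
    by (simp add: det_mul mult.commute mult.left_commute)
  have "(Id_mat + B) ** a = a + B"
  proof -
    have "B $ i $ l * a $ l $ j = (if l = j then B $ i $ j else 0)" for i l j
      by (auto simp: a_def B_def)
    then have "B ** a = B" by (simp add: vec_eq_iff matrix_matrix_mult_def)
    then show ?thesis by (simp add: matrix_add_rdistrib)
  qed
  moreover have "b ** (a + B) = k"
  proof -
    have "b $ i $ l * (a + B) $ l $ j = (if i \<in> P then if l = i then k $ i $ j else 0 else
        if l = j then k $ i $ j else 0)" for i l j
      by (auto simp: a_def B_def b_def QP)
    then have "(b ** (a + B)) $ i $ j = k $ i $ j" for i j
      unfolding matrix_matrix_mult_def by (cases "i \<in> P") simp_all
    then show ?thesis by (simp add: vec_eq_iff)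
  qed
  ultimately have "Determinants.det k = Determinants.det b * (Determinants.det (Id_mat + B) * Determinants.det a)"
    by (metis det_mul)
  moreover have "upper B" by (auto simp: upper_def B_def)
  then have "Determinants.det (Id_mat + B) > 0" by (simp add: det_unipotent upper_mult_upper)
  ultimately have "Determinants.det k = Determinants.det (Id_mat + B) * (Determinants.det a)\<^sup>2"
    by (simp add: det_b power2_eq_square)
  then show ?thesis using \<open>Determinants.det (Id_mat + B) > 0\<close> by simp
qed

text \<open>If \<open>g\<close> and \<open>h\<close> both carry \<open>J\<close> to
  \<open>y\<close>, then \<open>h^-1 g\<close> commutes with \<open>J\<close>, which rules out
  determinants of opposite sign.\<close>

lemma orb_disjoint: "orb 1 \<inter> orb (- 1) = {}"
proof (rule ccontr)
  assume "orb 1 \<inter> orb (- 1) \<noteq> {}"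
  then obtain y g h where g: "Determinants.det g > 0" "y ** g = g ** J"
    and h: "Determinants.det h < 0" "y ** h = h ** J" by (auto simp: orb_def)
  obtain k where k: "h ** k = Id_mat" "k ** h = Id_mat"
    using h(1) by (metis invertible_obtain_inverse less_irrefl)
  have "k ** g ** J = k ** y ** (h ** k) ** g"
    by (simp add: k g(2) flip: matrix_mul_assoc)
  also have "\<dots> = k ** (y ** h) ** k ** g" by (simp only: matrix_mul_assoc)
  also have "\<dots> = (k ** h) ** J ** (k ** g)" by (simp only: matrix_mul_assoc h(2))
  finally have "k ** g ** J = J ** (k ** g)" by (simp add: k)
  then have "Determinants.det k * Determinants.det g \<ge> 0"
    using det_commuting_nonneg by (metis det_mul)
  moreover have "Determinants.det k * Determinants.det h = 1" by (metis k(2) det_mul det_I)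
  moreover have "Determinants.det k < 0"
  proof (rule ccontr)
    assume "\<not> Determinants.det k < 0"
    then have "Determinants.det k * Determinants.det h \<le> 0"
      using h(1) by (intro mult_nonneg_nonpos) auto
    then show False using calculation(2) by simp
  qed
  ultimately show False using g(1) by (simp add: zero_le_mult_iff)
qed

section \<open>Square-zero matrices of rank \<open>m\<close> and the two orbits\<close>

lemma range_J: "range ((*v) J) = {v. \<forall>i. i \<notin> P \<longrightarrow> v $ i = 0}"
proof -
  have Jv: "(J *v v) $ i = (if i \<in> P then v $ s i else 0)" for v i
    by (simp add: matrix_vector_mult_def J_def if_distrib[of "\<lambda>x. x * _"] cong: if_cong)
  have "v = J *v (\<chi> i. v $ s i)" if "\<forall>i. i \<notin> P \<longrightarrow> v $ i = 0" for v
    using that by (simp add: vec_eq_iff Jv)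
  then show ?thesis by (auto simp: Jv)
qed

lemma rank_J: "rank J = m"
  using dim_substandard_cart[where 'a = real, of P] by (simp add: rank_dim_range range_J card_P dim_vec_eq)

text \<open>The columns of \<open>g\<close> are a basis \<open>r\<close> of the range of
  \<open>x\<close>, placed at \<open>P\<close>, and preimages \<open>e\<close> of it, placed outside
  \<open>P\<close>. If \<open>g *v v = 0\<close>, applying \<open>x\<close> gives
  \<open>g *v (J *v v) = 0\<close>; this involves only the independent vectors \<open>r\<close>, so
  first the part of \<open>v\<close> outside \<open>P\<close> vanishes and then the rest.\<close>

lemma square_zero_conj_J:
  assumes "x ** x = 0" "rank x = m"
  shows "\<exists>g. Determinants.det g \<noteq> 0 \<and> x ** g = g ** J"
proof -
  obtain B where B: "B \<subseteq> range ((*v) x)" "independent B" "card B = m"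
    using basis_exists[of "range ((*v) x)"] assms(2) by (metis rank_dim_range)
  have "finite B" using B(2) by (rule independent_imp_finite)
  then obtain r where r: "bij_betw r P B"
    using B(3) card_P finite_same_card_bij[of P B] by auto
  have "\<exists>e. x *v e = r i" if "i \<in> P" for i
    using bij_betwE[OF r] that B(1) by (metis image_iff subsetD)
  then obtain e where e: "\<And>i. i \<in> P \<Longrightarrow> x *v e i = r i" by metis
  define g :: "real^'n^'n" where "g = (\<chi> i j. if j \<in> P then r j $ i else e (s j) $ i)"
  have xr: "x *v r i = 0" if "i \<in> P" for i
    using e[OF that] assms(1) by (metis matrix_vector_mul_assoc matrix_vector_mult_0)
  have xg: "x ** g = g ** J"
  proof -
    have "(x ** g) $ i $ j = (x *v (\<chi> i. g $ i $ j)) $ i" for i j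
      by (simp add: matrix_matrix_mult_def matrix_vector_mult_def)
    moreover have "x *v (\<chi> i. g $ i $ j) = (if j \<in> P then 0 else r (s j))" for j
      using e[of "s j"] xr[of j] by (cases "j \<in> P") (simp_all add: g_def)
    ultimately show ?thesis by (simp add: vec_eq_iff mult_J_nth) (simp add: g_def)
  qed
  have supp: "u = 0" if u: "g *v u = 0" "\<And>i. i \<notin> P \<Longrightarrow> u $ i = 0" for u
  proof -
    have "g *v u = (\<Sum>i\<in>P. u $ i *\<^sub>R r i)"
    proof -
      have "(\<Sum>j\<in>UNIV. g $ i $ j * u $ j) = (\<Sum>j\<in>P. u $ j * r j $ i)" for i
        by (rule sum.mono_neutral_cong_right) (auto simp: u(2) g_def)
      then show ?thesis by (simp add: vec_eq_iff matrix_vector_mult_def)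
    qed
    also have "\<dots> = (\<Sum>w\<in>B. u $ inv_into P r w *\<^sub>R w)"
      using bij_betw_inv_into_left[OF r]
      by (subst sum.reindex_bij_betw[OF r, symmetric]) (auto intro!: sum.cong)
    finally have "(\<Sum>w\<in>B. u $ inv_into P r w *\<^sub>R w) = 0" using u(1) by simp
    then have "u $ inv_into P r (r i) = 0" if "i \<in> P" for i
      using independentD[OF B(2) \<open>finite B\<close> subset_refl, of "\<lambda>w. u $ inv_into P r w" "r i"]
        bij_betwE[OF r] that by blast
    then have "u $ i = 0" for i
      using u(2) bij_betw_inv_into_left[OF r] by (cases "i \<in> P") auto
    then show ?thesis by (simp add: vec_eq_iff)
  qed
  have "v = 0" if gv: "g *v v = 0" for v
  proof -
    have Jv: "(J *v v) $ i = (if i \<in> P then v $ s i else 0)" for i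
      by (simp add: matrix_vector_mult_def J_def if_distrib[of "\<lambda>x. x * _"] cong: if_cong)
    have "g *v (J *v v) = 0"
      using gv xg by (metis matrix_vector_mul_assoc matrix_vector_mult_0_right)
    then have "J *v v = 0" by (rule supp) (simp add: Jv)
    then have "v $ i = 0" if "i \<notin> P" for i
      using Jv[of "s i"] that by simp
    then show "v = 0" using supp gv by blast
  qed
  then have "\<exists>h. h ** g = Id_mat" by (simp add: matrix_left_invertible_ker)
  then have "Determinants.det g \<noteq> 0"
    by (metis det_mul det_I mult_zero_right zero_neq_one)
  with xg show ?thesis by blast
qed

lemma orb_union: "orb 1 \<union> orb (- 1) = {x \<in> sl. x ** x = 0 \<and> rank x = m}"
proof (intro equalityI subsetI)
  fix x assume "x \<in> orb 1 \<union> orb (- 1)"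
  then have "\<exists>g. Determinants.det g \<noteq> 0 \<and> x ** g = g ** J"
    by (auto simp: orb_def) (metis less_irrefl)+
  then obtain g where "Determinants.det g \<noteq> 0" and xg: "x ** g = g ** J" by blast
  then obtain h where h: "g ** h = Id_mat" "h ** g = Id_mat" using invertible_obtain_inverse by metis
  have x: "x = g ** J ** h" using xg h by (metis matrix_mul_assoc matrix_mul_rid)
  have "J = h ** x ** g" using xg h by (metis matrix_mul_assoc matrix_mul_lid)
  then have "rank J \<le> rank x" by (metis rank_mul_le_left rank_mul_le_right order_trans)
  moreover have "rank x \<le> rank J" unfolding x by (metis rank_mul_le_left rank_mul_le_right order_trans)
  moreover have "x ** x = g ** J ** (h ** g) ** J ** h" unfolding x by (simp only: matrix_mul_assoc)
  then have "x ** x = g ** (J ** J) ** h" by (simp add: h matrix_mul_assoc)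
  moreover have "trace x = 0" unfolding x by (simp add: trace_conj h trace_upper upper_J)
  ultimately show "x \<in> {x \<in> sl. x ** x = 0 \<and> rank x = m}" by (simp add: rank_J J_sq sl_def)
next
  fix x :: "real^'n^'n" assume "x \<in> {x \<in> sl. x ** x = 0 \<and> rank x = m}"
  then obtain g where "Determinants.det g \<noteq> 0" "x ** g = g ** J"
    using square_zero_conj_J by blast
  then show "x \<in> orb 1 \<union> orb (- 1)"
    unfolding orb_def by (cases "Determinants.det g > 0") auto
qed

end

section \<open>Jordan normal forms\<close>

lemma to_mat_carrier [simp]: "to_mat f (X :: real^'n^'n) \<in> carrier_mat CARD('n) CARD('n)"
  by (simp add: to_mat_def)

lemma to_mat_mult:
  assumes "bij_betw f {..<CARD('n)} (UNIV :: 'n::finite set)"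
  shows "to_mat f (A ** B) = to_mat f A * to_mat f (B :: real^'n^'n)"
proof (rule eq_matI)
  fix i j assume "i < dim_row (to_mat f A * to_mat f B)" "j < dim_col (to_mat f A * to_mat f B)"
  then have ij: "i < CARD('n)" "j < CARD('n)" by (simp_all add: to_mat_def)
  have "(\<Sum>k\<in>UNIV. A $ f i $ k * B $ k $ f j) = (\<Sum>k<CARD('n). A $ f i $ f k * B $ f k $ f j)"
    by (rule sum.reindex_bij_betw[OF assms, symmetric])
  then show "to_mat f (A ** B) $$ (i, j) = (to_mat f A * to_mat f B) $$ (i, j)"
    using ij by (simp add: to_mat_def matrix_matrix_mult_def scalar_prod_def lessThan_atLeast0)
qed (simp_all add: to_mat_def)

lemma to_mat_one:
  assumes "bij_betw f {..<CARD('n)} (UNIV :: 'n::finite set)"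
  shows "to_mat f (Id_mat :: real^'n^'n) = 1\<^sub>m CARD('n)"
  using bij_betw_imp_inj_on[OF assms]
  by (intro eq_matI) (auto simp: to_mat_def Finite_Cartesian_Product.mat_def inj_on_def)

lemma to_mat_inject:
  assumes "bij_betw f {..<CARD('n)} (UNIV :: 'n::finite set)" and eq: "to_mat f X = to_mat f (Y :: real^'n^'n)"
  shows "X = Y"
proof -
  have "X $ i $ j = Y $ i $ j" for i j
  proof -
    obtain k l where "k < CARD('n)" "l < CARD('n)" "i = f k" "j = f l"
      using bij_betw_imp_surj_on[OF assms(1)] by (metis UNIV_I imageE lessThan_iff)
    then show ?thesis using arg_cong[OF eq, of "\<lambda>A. A $$ (k, l)"] by (simp add: to_mat_def)
  qed
  then show ?thesis by (simp add: vec_eq_iff)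
qed

lemma to_mat_surj:
  assumes "bij_betw f {..<CARD('n)} (UNIV :: 'n::finite set)" "A \<in> carrier_mat CARD('n) CARD('n)"
  shows "\<exists>X :: real^'n^'n. to_mat f X = A"
proof
  show "to_mat f (\<chi> i j. A $$ (inv_into {..<CARD('n)} f i, inv_into {..<CARD('n)} f j)) = A"
    using assms by (intro eq_matI) (auto simp: to_mat_def bij_betw_inv_into_left)
qed

lemma similar_to_mat_iff:
  fixes X Y :: "real^'n::finite^'n"
  assumes f: "bij_betw f {..<CARD('n)} (UNIV :: 'n set)"
  shows "similar_mat (to_mat f X) (to_mat f Y) \<longleftrightarrow> (\<exists>g. Determinants.det g \<noteq> 0 \<and> X ** g = g ** Y)"
proof
  assume "similar_mat (to_mat f X) (to_mat f Y)"
  then obtain A B where wit: "similar_mat_wit (to_mat f X) (to_mat f Y) A B" by (auto simp: similar_mat_def)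
  have AB: "A * B = 1\<^sub>m CARD('n)" "B * A = 1\<^sub>m CARD('n)" "to_mat f X = A * to_mat f Y * B"
    "A \<in> carrier_mat CARD('n) CARD('n)" "B \<in> carrier_mat CARD('n) CARD('n)"
    by (intro similar_mat_witD2[OF to_mat_carrier wit])+
  then obtain g h :: "real^'n^'n" where gh: "to_mat f g = A" "to_mat f h = B"
    using to_mat_surj[OF f] by metis
  have X: "X = g ** Y ** h"
    by (rule to_mat_inject[OF f]) (simp only: to_mat_mult[OF f] gh AB(3))
  have hg: "h ** g = Id_mat"
    by (rule to_mat_inject[OF f]) (simp add: to_mat_mult[OF f] to_mat_one[OF f] gh AB)
  have "Determinants.det h * Determinants.det g = 1" by (metis hg det_mul det_I)
  then have "Determinants.det g \<noteq> 0" by auto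
  moreover have "X ** g = g ** Y" unfolding X by (simp add: hg flip: matrix_mul_assoc)
  ultimately show "\<exists>g. Determinants.det g \<noteq> 0 \<and> X ** g = g ** Y" by blast
next
  assume "\<exists>g. Determinants.det g \<noteq> 0 \<and> X ** g = g ** Y"
  then obtain g h where gh: "X ** g = g ** Y" "g ** h = Id_mat" "h ** g = Id_mat"
    using invertible_obtain_inverse by metis
  then have X: "X = g ** Y ** h" by (metis matrix_mul_assoc matrix_mul_rid)
  show "similar_mat (to_mat f X) (to_mat f Y)"
  proof (rule similar_matI)
    show "to_mat f X = to_mat f g * to_mat f Y * to_mat f h"
      unfolding X by (simp add: to_mat_mult[OF f])
    show "to_mat f g * to_mat f h = 1\<^sub>m CARD('n)" "to_mat f h * to_mat f g = 1\<^sub>m CARD('n)"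
      by (simp_all add: gh to_mat_one[OF f] flip: to_mat_mult[OF f])
  qed auto
qed

lemma jordan_matrix_replicate_2_0:
  "jordan_matrix (replicate k (2, 0 :: real)) =
     Matrix.mat (2 * k) (2 * k) (\<lambda>(i, j). if even i \<and> j = Suc i then 1 else 0)"
proof (induction k)
  case 0
  then show ?case by (auto simp: jordan_matrix_def)
next
  case (Suc k)
  have len: "sum_list (map fst (replicate k (2 :: nat, 0 :: real))) = 2 * k"
    by (simp add: sum_list_replicate)
  have block: "jordan_block 2 (0 :: real) $$ (i, j) = (if i = 0 \<and> j = 1 then 1 else 0)" if "i < 2" "j < 2" for i j
    using that by (auto simp: jordan_block_def)
  show ?case
    unfolding replicate_Suc jordan_matrix_Cons Suc.IH len
  proof (rule eq_matI, goal_cases)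
    case (1 i j)
    then have lt: "i < 2 * Suc k" "j < 2 * Suc k" by simp_all
    consider "i < 2" "j < 2" | "i < 2" "\<not> j < 2" | "\<not> i < 2" "j < 2" | "\<not> i < 2" "\<not> j < 2" by blast
    then show ?case
    proof cases
      case 1
      then have "(even i \<and> j = Suc i) = (i = 0 \<and> j = 1)" by presburger
      then show ?thesis using 1 block[of i j] by simp
    next
      case 2
      then have "\<not> (even i \<and> j = Suc i)" by presburger
      then show ?thesis using 2 lt by simp
    next
      case 3
      then show ?thesis using lt by simp
    next
      case 4
      then have "(even (i - 2) \<and> j - 2 = Suc (i - 2)) = (even i \<and> j = Suc i)" by presburger
      moreover have "i - 2 < 2 * k" "j - 2 < 2 * k" using 4 lt by simp_all
      ultimately show ?thesis using 4 by simp
    qed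
  qed simp_all
qed

text \<open>\<open>nilpotents_2\<close> prescribes the block sizes only; the eigenvalues have to be
  derived. Each one is a root of the characteristic polynomial, and an eigenvector gives
  \<open>a * a = 0\<close>.\<close>

lemma jordan_nf_square_zero:
  assumes "jordan_nf A n_as" "A \<in> carrier_mat n n" "A * A = 0\<^sub>m n n" "(k, a :: real) \<in> set n_as"
  shows "a = 0"
proof -
  \<comment> \<open>A block of size 0 would contribute the factor 1, which has no root.\<close>
  have "k \<noteq> 0" using assms(1,4) by (force simp: jordan_nf_def)
  then have "poly ([:- a, 1:] ^ k) a = 0" by simp
  then have "poly (char_poly A) a = 0"
    unfolding jordan_nf_char_poly[OF assms(1)] poly_prod_list
    using assms(4) by (force simp: prod_list_zero_iff)
  then have "eigenvalue A a" using eigenvalue_root_char_poly[OF assms(2)] by simp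
  then obtain v where v: "v \<in> carrier_vec n" "v \<noteq> 0\<^sub>v n" "A *\<^sub>v v = a \<cdot>\<^sub>v v"
    using assms(2) by (auto simp: eigenvalue_def eigenvector_def)
  have "0\<^sub>v n = (A * A) *\<^sub>v v" unfolding assms(3) using v(1) by (intro eq_vecI) auto
  also have "\<dots> = A *\<^sub>v (A *\<^sub>v v)" using assms(2) v(1) by simp
  also have "\<dots> = (a * a) \<cdot>\<^sub>v v"
    unfolding v(3) using assms(2) v(1) by (simp add: mult_mat_vec v(3) smult_smult_assoc)
  finally have eq: "0\<^sub>v n = (a * a) \<cdot>\<^sub>v v" .
  have "\<exists>i<n. vec_index v i \<noteq> 0"
  proof (rule ccontr)
    assume "\<not> (\<exists>i<n. vec_index v i \<noteq> 0)"
    then have "v = 0\<^sub>v n" using v(1) by (intro eq_vecI) auto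
    then show False using v(2) by simp
  qed
  then obtain i where "i < n" "vec_index v i \<noteq> 0" by blast
  then show ?thesis using arg_cong[OF eq, of "\<lambda>w. vec_index w i"] v(1) by simp
qed

context pairing
begin

text \<open>Equality on the nose, not mere similarity: this is the benefit of taking
  \<open>P\<close> to be the even positions instead of the first \<open>m\<close>.\<close>

lemma to_mat_J: "to_mat f J = jordan_matrix (replicate m (2, 0))"
proof -
  have "f j = s (f i) \<longleftrightarrow> j = partner i" if "i < 2 * m" "j < 2 * m" for i j
    using that bij_betw_imp_inj_on[OF bij_f] partner_less by (auto simp: s_def inj_on_def)
  then show ?thesis
    unfolding jordan_matrix_replicate_2_0
    by (intro eq_matI) (auto simp: to_mat_def card_n J_def P_def partner_def)
qed

lemma orb_union_eq: "orb 1 \<union> orb (- 1) = {x. \<exists>g. Determinants.det g \<noteq> 0 \<and> x ** g = g ** J}"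
proof -
  have "d \<noteq> 0 \<longleftrightarrow> 1 * d > 0 \<or> - 1 * d > 0" for d :: real by auto
  then show ?thesis unfolding orb_def by blast
qed

lemma square_zero_jordan_form_iff:
  fixes x :: "real^'n^'n"
  assumes "x ** x = 0"
  shows "(\<exists>n_as. jordan_nf (to_mat f x) n_as \<and> (\<forall>(k, a)\<in>set n_as. k = 2)) \<longleftrightarrow> x \<in> orb 1 \<union> orb (- 1)"
proof
  have f: "bij_betw f {..<CARD('n)} UNIV" using bij_f by (simp add: card_n)
  assume "\<exists>n_as. jordan_nf (to_mat f x) n_as \<and> (\<forall>(k, a)\<in>set n_as. k = 2)"
  then obtain n_as where jnf: "jordan_nf (to_mat f x) n_as" and two: "\<forall>(k, a)\<in>set n_as. k = 2" by blast
  have "to_mat f x * to_mat f x = 0\<^sub>m CARD('n) CARD('n)"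
    unfolding to_mat_mult[OF f, symmetric] assms by (auto simp: to_mat_def)
  then have "a = 0" if "(k, a) \<in> set n_as" for k a
    using jordan_nf_square_zero[OF jnf to_mat_carrier] that by blast
  then have "z = (2, 0)" if "z \<in> set n_as" for z
    using two that by (cases z) auto
  then have eq: "n_as = replicate (length n_as) (2, 0)"
    by (simp add: replicate_length_same)
  have sim: "similar_mat (to_mat f x) (jordan_matrix n_as)" using jnf by (simp add: jordan_nf_def)
  then have "dim_row (jordan_matrix n_as) = CARD('n)"
    using similar_matD[OF sim] to_mat_carrier[of f x] by (metis carrier_matD(1) insert_subset)
  then have "sum_list (map fst n_as) = 2 * m"
    by (simp add: card_n)
  then have "sum_list (map fst (replicate (length n_as) (2 :: nat, 0 :: real))) = 2 * m"
    by (simp only: eq[symmetric])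
  then have "length n_as = m" by (simp add: sum_list_replicate)
  then have "n_as = replicate m (2, 0)" using eq by (simp only:)
  then have "similar_mat (to_mat f x) (to_mat f J)" using sim unfolding to_mat_J by (simp only:)
  then show "x \<in> orb 1 \<union> orb (- 1)" unfolding orb_union_eq similar_to_mat_iff[OF f] by simp
next
  have f: "bij_betw f {..<CARD('n)} UNIV" using bij_f by (simp add: card_n)
  assume "x \<in> orb 1 \<union> orb (- 1)"
  then have "jordan_nf (to_mat f x) (replicate m (2, 0))"
    unfolding orb_union_eq jordan_nf_def to_mat_J[symmetric] by (auto simp: similar_to_mat_iff[OF f])
  then show "\<exists>n_as. jordan_nf (to_mat f x) n_as \<and> (\<forall>(k, a)\<in>set n_as. k = 2)"
    by (intro exI[of _ "replicate m (2, 0)"]) auto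
qed

end

text \<open>\<open>jordan_form\<close> allows any enumeration, so the locale is instantiated for
  each of them. Every enumeration has its own \<open>J\<close> and its own \<open>orb\<close>, but
  \<open>orb_union\<close> describes their union by the same rank condition.\<close>

lemma nilpotents_2_eq:
  assumes card: "CARD('n::finite) = 2 * m" and m: "m > 1"
  shows "(nilpotents_2 :: (real^'n^'n) set) = {x \<in> sl. x ** x = 0 \<and> rank x = m}"
proof -
  have pairing: "pairing m f" if "bij_betw f {..<CARD('n)} (UNIV :: 'n set)" for f
    using that card m by unfold_locales auto
  have "(\<exists>n_as. jordan_form x n_as \<and> (\<forall>(k, a)\<in>set n_as. k = 2)) \<longleftrightarrow> rank x = m"
    if x: "x \<in> sl" "x ** x = 0" for x :: "real^'n^'n"
  proof -
    have iff: "(\<exists>n_as. jordan_nf (to_mat f x) n_as \<and> (\<forall>(k, a)\<in>set n_as. k = 2)) \<longleftrightarrow> rank x = m"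
      if "bij_betw f {..<CARD('n)} (UNIV :: 'n set)" for f
      using pairing.square_zero_jordan_form_iff[OF pairing[OF that] x(2)]
        pairing.orb_union[OF pairing[OF that]] x by simp
    moreover obtain f where "bij_betw f {..<CARD('n)} (UNIV :: 'n set)"
      using ex_bij_betw_nat_finite[of "UNIV :: 'n set"] by (auto simp: lessThan_atLeast0)
    ultimately show ?thesis unfolding jordan_form_def by blast
  qed
  moreover have "x \<noteq> 0" if "rank x = m" for x :: "real^'n^'n" using that m by auto
  ultimately show ?thesis unfolding nilpotents_2_def by blast
qed

section \<open>A chart of the orbit\<close>

lemma bounded_bilinear_matrix_mult: "bounded_bilinear ((**) :: real^'n^'n \<Rightarrow> real^'n^'n \<Rightarrow> real^'n^'n)"
  unfolding bilinear_conv_bounded_bilinear[symmetric] bilinear_def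
  by (intro conjI allI linearI) (simp_all add: matrix_algebra)

lemma continuous_on_matrix_mult:
  fixes A B :: "'a::topological_space \<Rightarrow> real^'n^'n"
  assumes "continuous_on S A" "continuous_on S B"
  shows "continuous_on S (\<lambda>x. A x ** B x)"
  by (rule bounded_bilinear.continuous_on[OF bounded_bilinear_matrix_mult assms])

lemma continuous_on_det:
  fixes A :: "'a::topological_space \<Rightarrow> real^'n^'n"
  assumes "continuous_on S A"
  shows "continuous_on S (\<lambda>x. Determinants.det (A x))"
  unfolding Determinants.det_def by (intro continuous_intros assms)

text \<open>Along every coordinate line the chart is a polynomial of degree at most 2, so this
  covers all partial derivatives.\<close>

lemma has_vector_derivative_quadratic:
  "((\<lambda>t. a + (t - t0) *\<^sub>R b + ((t - t0)\<^sup>2) *\<^sub>R c) has_vector_derivative b) (at t0)"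
  by (auto intro!: derivative_eq_intros)

context pairing
begin

text \<open>Even coordinates fill \<open>B\<close> and odd ones \<open>C\<close>, so conjugate
  coordinates are adjacent, as \<open>partner\<close> requires.\<close>

definition Bm :: "(nat \<Rightarrow> real) \<Rightarrow> real^'n^'n" where
  "Bm x = (\<Sum>k<m * m. x (2 * k) *\<^sub>R munit (p k) (q k))"

definition Cm :: "(nat \<Rightarrow> real) \<Rightarrow> real^'n^'n" where
  "Cm x = (\<Sum>k<m * m. x (Suc (2 * k)) *\<^sub>R munit (q k) (p k))"

definition chart :: "(nat \<Rightarrow> real) \<Rightarrow> real^'n^'n" where
  "chart x = phi (Bm x) (Cm x)"

definition chart_dom :: "real \<Rightarrow> (nat \<Rightarrow> real) set" where
  "chart_dom \<sigma> = {x \<in> coord_space (2 * (m * m)). \<sigma> * Determinants.det (frame (Bm x)) > 0}"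

lemma upper_Bm: "upper (Bm x)"
proof -
  have "Bm x $ i $ j = 0" if "\<not> (i \<in> P \<and> j \<notin> P)" for i j
    using that p_in q_in by (auto simp: Bm_def munit_nth intro!: sum.neutral)
  then show ?thesis by (auto simp: upper_def)
qed

lemma lower_Cm: "lower (Cm x)"
proof -
  have "Cm x $ i $ j = 0" if "\<not> (i \<notin> P \<and> j \<in> P)" for i j
    using that p_in q_in by (auto simp: Cm_def munit_nth intro!: sum.neutral)
  then show ?thesis by (auto simp: lower_def)
qed

lemma Bm_nth: "k < m * m \<Longrightarrow> Bm x $ p k $ q k = x (2 * k)"
proof -
  assume k: "k < m * m"
  have "Bm x $ p k $ q k = (\<Sum>l<m * m. if l = k then x (2 * k) else 0)"
    unfolding Bm_def sum_component vector_scaleR_component munit_nth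
    using pq_inj[OF k] by (intro sum.cong) auto
  then show ?thesis using k by simp
qed

lemma Cm_nth: "k < m * m \<Longrightarrow> Cm x $ q k $ p k = x (Suc (2 * k))"
proof -
  assume k: "k < m * m"
  have "Cm x $ q k $ p k = (\<Sum>l<m * m. if l = k then x (Suc (2 * k)) else 0)"
    unfolding Cm_def sum_component vector_scaleR_component munit_nth
    using pq_inj[OF k] by (intro sum.cong) auto
  then show ?thesis using k by simp
qed

lemma Bm_of_upper:
  assumes "upper B" shows "Bm (\<lambda>a. B $ p (a div 2) $ q (a div 2)) = B"
proof -
  have "Bm (\<lambda>a. B $ p (a div 2) $ q (a div 2)) $ i $ j = B $ i $ j" for i j
  proof (cases "i \<in> P \<and> j \<notin> P")
    case True
    then obtain k where "k < m * m" "p k = i" "q k = j" using pq_surj by blast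
    then show ?thesis using Bm_nth[of k "\<lambda>a. B $ p (a div 2) $ q (a div 2)"] by simp
  next
    case False
    then show ?thesis using assms upper_Bm by (auto simp: upperD)
  qed
  then show ?thesis by (simp add: vec_eq_iff)
qed

lemma Bm_upd_even:
  assumes "k < m * m" shows "Bm (x(2 * k := t)) = Bm x + (t - x (2 * k)) *\<^sub>R munit (p k) (q k)"
proof -
  have "Bm (x(2 * k := t)) = (\<Sum>l<m * m. x (2 * l) *\<^sub>R munit (p l) (q l) +
      (if l = k then (t - x (2 * k)) *\<^sub>R munit (p k) (q k) else 0))"
    unfolding Bm_def by (intro sum.cong) (auto simp: algebra_simps)
  then show ?thesis using assms by (simp add: sum.distrib Bm_def)
qed

lemma Cm_upd_odd:
  assumes "k < m * m" shows "Cm (x(Suc (2 * k) := t)) = Cm x + (t - x (Suc (2 * k))) *\<^sub>R munit (q k) (p k)"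
proof -
  have "Cm (x(Suc (2 * k) := t)) = (\<Sum>l<m * m. x (Suc (2 * l)) *\<^sub>R munit (q l) (p l) +
      (if l = k then (t - x (Suc (2 * k))) *\<^sub>R munit (q k) (p k) else 0))"
    unfolding Cm_def by (intro sum.cong) (auto simp: algebra_simps)
  then show ?thesis using assms by (simp add: sum.distrib Cm_def)
qed

lemma Bm_upd_odd: "Bm (x(Suc (2 * k) := t)) = Bm x"
  unfolding Bm_def
proof (intro sum.cong refl arg_cong2[where f = scaleR])
  fix l have "2 * l \<noteq> Suc (2 * k)" by presburger
  then show "(x(Suc (2 * k) := t)) (2 * l) = x (2 * l)" by simp
qed

lemma Cm_upd_even: "Cm (x(2 * k := t)) = Cm x"
  unfolding Cm_def
proof (intro sum.cong refl arg_cong2[where f = scaleR])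
  fix l have "Suc (2 * l) \<noteq> 2 * k" by presburger
  then show "(x(2 * k := t)) (Suc (2 * l)) = x (Suc (2 * l))" by simp
qed

lemma chart_has_vector_derivative:
  assumes "a < 2 * (m * m)"
  shows "((\<lambda>t. chart (x(a := t))) has_vector_derivative tvec (Bm x) (Cm x) a) (at (x a))"
proof -
  let ?B = "Bm x" and ?C = "Cm x"
  define k where "k = a div 2"
  have k: "k < m * m" using assms by (simp add: k_def)
  let ?E = "munit (p k) (q k) :: real^'n^'n" and ?F = "munit (q k) (p k) :: real^'n^'n"
  have "\<exists>c. \<forall>t. chart (x(a := t)) = chart x + (t - x a) *\<^sub>R tvec ?B ?C a + ((t - x a)\<^sup>2) *\<^sub>R c"
  proof (cases "even a")
    case True
    then have a: "a = 2 * k" by (simp add: k_def)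
    have "phi (?B + s *\<^sub>R ?E) ?C = phi ?B ?C + s *\<^sub>R ((Id_mat + ?C) ** ?E ** (Id_mat - ?C))" for s
      by (simp add: phi_def matrix_add_ldistrib matrix_add_rdistrib matrix_mul_scaleR_left
          matrix_mul_scaleR_right)
    then show ?thesis
      unfolding a chart_def Bm_upd_even[OF k] Cm_upd_even by (intro exI[of _ 0]) (simp add: tvec_def)
  next
    case False
    then have a: "a = Suc (2 * k)" by (simp add: k_def)
    have F: "lower ?F" using k by (simp add: lower_munit p_in q_in)
    have FC: "?F ** (?C ** Z) = 0" "?C ** ?F = 0" for Z
      using F lower_Cm by (simp_all add: lower_mult_lower matrix_mul_assoc)
    \<comment> \<open>The quadratic term arises because \<open>C\<close> occurs on both sides of
      \<open>B\<close>; the relations \<open>FC\<close> turn the linear term into a bracket.\<close>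
    have "phi ?B (?C + s *\<^sub>R ?F) = phi ?B ?C + s *\<^sub>R lie_bracket ?F (phi ?B ?C) + s\<^sup>2 *\<^sub>R (- (?F ** ?B ** ?F))" for s
      by (simp add: phi_def lie_bracket_def matrix_algebra FC power2_eq_square algebra_simps)
    then show ?thesis
      unfolding a chart_def Bm_upd_odd Cm_upd_odd[OF k] by (intro exI[of _ "- (?F ** ?B ** ?F)"]) (simp add: tvec_def)
  qed
  then obtain c where "(\<lambda>t. chart (x(a := t))) =
      (\<lambda>t. chart x + (t - x a) *\<^sub>R tvec ?B ?C a + ((t - x a)\<^sup>2) *\<^sub>R c)" by blast
  then show ?thesis by (simp only: has_vector_derivative_quadratic)
qed

lemma partial_deriv_chart:
  "a < 2 * (m * m) \<Longrightarrow> partial_deriv a chart x = tvec (Bm x) (Cm x) a"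
  unfolding partial_deriv_def by (rule vector_derivative_at[OF chart_has_vector_derivative])

lemma continuous_on_Bm: "continuous_on S Bm" and continuous_on_Cm: "continuous_on S Cm"
proof -
  have "continuous_on S (\<lambda>x :: nat \<Rightarrow> real. x i)" for i
    by (rule continuous_on_subset[OF continuous_on_product_coordinates]) simp
  then show "continuous_on S Bm" "continuous_on S Cm"
    unfolding Bm_def[abs_def] Cm_def[abs_def] by (auto intro!: continuous_intros)
qed

lemma continuous_on_frame: "continuous_on S A \<Longrightarrow> continuous_on S (\<lambda>x. frame (A x))"
  unfolding frame_def
proof (intro continuous_on_vec_lambda)
  fix i j assume "continuous_on S A"
  then show "continuous_on S (\<lambda>x. if j \<in> P then A x $ i $ s j else if i = j then 1 else 0)"
    by (cases "j \<in> P") (auto intro!: continuous_intros)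
qed

lemma continuous_on_phi:
  "continuous_on S A \<Longrightarrow> continuous_on S A' \<Longrightarrow> continuous_on S (\<lambda>x. phi (A x) (A' x))"
  unfolding phi_def by (intro continuous_on_matrix_mult continuous_intros)

lemma continuous_on_tvec: "continuous_on S (\<lambda>x. tvec (Bm x) (Cm x) a)"
  unfolding tvec_def lie_bracket_def
  by (cases "even a")
     (auto intro!: continuous_on_matrix_mult continuous_intros continuous_on_phi continuous_on_Bm continuous_on_Cm)

lemma chart_in_orb:
  assumes "x \<in> chart_dom \<sigma>" shows "chart x \<in> orb \<sigma>"
proof -
  have "Determinants.det (Id_mat + Cm x) > 0"
    by (simp add: det_unipotent lower_mult_lower lower_Cm)
  moreover have "\<sigma> * Determinants.det (frame (Bm x)) > 0" using assms by (simp add: chart_dom_def)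
  ultimately have "\<sigma> * Determinants.det ((Id_mat + Cm x) ** frame (Bm x)) > 0"
    unfolding det_mul by (subst mult.left_commute) (rule mult_pos_pos)
  then show ?thesis
    unfolding orb_def chart_def using phi_frame[OF upper_Bm lower_Cm] by blast
qed

text \<open>Expanding, the upper right block of \<open>phi B C\<close> is \<open>B\<close> and the
  lower right block is the product \<open>C B\<close>. Hence \<open>B\<close> is visible directly,
  and its invertibility, expressed through \<open>frame\<close>, recovers \<open>C\<close>.\<close>

lemma phi_inject:
  assumes B: "upper B" "upper B'" and C: "lower C" "lower C'" and eq: "phi B C = phi B' C'"
    and det: "Determinants.det (frame B) \<noteq> 0"
  shows "B = B'" "C = C'"
proof -
  have phi_eq: "phi B C = B + C ** B - (B ** C + C ** (B ** C))" for B C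
    by (simp add: phi_def matrix_algebra algebra_simps)
  have Ci: "(C ** Z) $ i $ j = 0" if "lower C" "i \<in> P" for C Z :: "real^'n^'n" and i j
    using that by (simp add: matrix_matrix_mult_def lowerD)
  have Cj: "(Z ** C) $ i $ j = 0" if "lower C" "j \<notin> P" for C Z :: "real^'n^'n" and i j
    using that by (simp add: matrix_matrix_mult_def lowerD)
  have Bj: "(Z ** B) $ i $ j = 0" if "upper B" "j \<in> P" for B Z :: "real^'n^'n" and i j
    using that by (simp add: matrix_matrix_mult_def upperD)
  have PQ: "phi B C $ i $ j = B $ i $ j" if "upper B" "lower C" "i \<in> P" "j \<notin> P" for B C i j
    unfolding phi_eq using that by (simp add: Ci Cj)
  have QQ: "phi B C $ i $ j = (C ** B) $ i $ j" if "upper B" "lower C" "i \<notin> P" "j \<notin> P" for B C i j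
    unfolding phi_eq using that by (simp add: Cj matrix_mul_assoc upperD)
  have "B $ i $ j = B' $ i $ j" for i j
    using PQ[OF B(1) C(1)] PQ[OF B(2) C(2)] eq B by (cases "i \<in> P \<and> j \<notin> P") (auto simp: upperD)
  then show BB': "B = B'" by (simp add: vec_eq_iff)
  have "(C ** B) $ i $ j = (C' ** B) $ i $ j" for i j
    using QQ[OF B(1) C(1)] QQ[OF B(2) C(2)] eq BB' B C
    by (cases "i \<notin> P \<and> j \<notin> P") (auto simp: Ci Bj)
  then have CB: "(C - C') ** B = 0" by (simp add: vec_eq_iff matrix_mul_diff_left)
  define D where "D = C - C'"
  have "D $ i $ j = 0" if "\<not> (i \<notin> P \<and> j \<in> P)" for i j
    using that C by (auto simp: D_def lowerD)
  then have D: "lower D" by (auto simp: lower_def)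
  \<comment> \<open>The columns of \<open>D ** frame B\<close> in \<open>P\<close> are those of
    \<open>D ** B\<close>, merely shifted by \<open>J\<close>; the remaining columns vanish since
    \<open>D\<close> is lower.\<close>
  have "D ** B = D ** frame B ** J" by (simp add: frame_J B flip: matrix_mul_assoc)
  then have DJ: "D ** frame B ** J = 0" using CB by (simp add: D_def)
  have "(D ** frame B) $ i $ j = 0" for i j
  proof (cases "j \<in> P")
    case True
    then show ?thesis using mult_J_nth[of "D ** frame B" i "s j"] DJ by simp
  next
    case False
    then have "D $ i $ k * frame B $ k $ j = 0" for k
      using D by (simp add: frame_def lowerD)
    then show ?thesis by (simp add: matrix_matrix_mult_def sum.neutral del: mult_eq_0_iff)
  qed
  then have "D ** frame B = 0" by (simp add: vec_eq_iff)
  moreover obtain h where "frame B ** h = Id_mat" using det by (rule invertible_obtain_inverse)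
  ultimately have "D = 0" by (metis matrix_mul_assoc matrix_mul_rid times0_left)
  then show "C = C'" by (simp add: D_def)
qed

lemma inj_on_chart: "inj_on chart (chart_dom \<sigma>)"
proof (rule inj_onI)
  fix x y assume xy: "x \<in> chart_dom \<sigma>" "y \<in> chart_dom \<sigma>" "chart x = chart y"
  then have "Determinants.det (frame (Bm x)) \<noteq> 0" by (auto simp: chart_dom_def)
  then have BC: "Bm x = Bm y" "Cm x = Cm y"
    using phi_inject[OF upper_Bm upper_Bm lower_Cm lower_Cm] xy(3) unfolding chart_def by blast+
  \<comment> \<open>\<open>Bm\<close> and \<open>Cm\<close> determine the coordinates below
    \<open>2 * (m * m)\<close>; points of \<open>coord_space\<close> are extensional, which settles
    the others.\<close>
  show "x = y"
  proof (rule PiE_ext)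
    show "x \<in> {..<2 * (m * m)} \<rightarrow>\<^sub>E UNIV" "y \<in> {..<2 * (m * m)} \<rightarrow>\<^sub>E UNIV"
      using xy by (auto simp: chart_dom_def coord_space_def)
    fix a assume "a \<in> {..<2 * (m * m)}"
    then have k: "a div 2 < m * m" by auto
    show "x a = y a"
    proof (cases "even a")
      case True
      then show ?thesis using Bm_nth[OF k, of x] Bm_nth[OF k, of y] BC by simp
    next
      case False
      then show ?thesis using Cm_nth[OF k, of x] Cm_nth[OF k, of y] BC by simp
    qed
  qed
qed

lemma open_frame_det: "open {x. \<sigma> * Determinants.det (frame (Bm x)) > 0}"
  by (intro open_Collect_less continuous_intros continuous_on_det continuous_on_frame continuous_on_Bm)

lemma orbit_chart_chart:
  assumes "\<sigma> = 1 \<or> \<sigma> = - 1"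
  shows "orbit_chart (orb \<sigma>) (chart_dom \<sigma>) chart"
  unfolding orbit_chart_def orbit_dim_orb[OF assms]
proof (intro conjI ballI allI impI)
  have "chart_dom \<sigma> = coord_space (2 * (m * m)) \<inter> {x. \<sigma> * Determinants.det (frame (Bm x)) > 0}"
    by (auto simp: chart_dom_def)
  then show "openin (top_of_set (coord_space (2 * (m * m)))) (chart_dom \<sigma>)"
    using openin_open_Int[OF open_frame_det] by metis
  show "inj_on chart (chart_dom \<sigma>)" by (rule inj_on_chart)
  show "chart ` chart_dom \<sigma> \<subseteq> orb \<sigma>" using chart_in_orb by auto
next
  fix a x assume "a < 2 * (m * m)" "x \<in> chart_dom \<sigma>"
  then show "(\<lambda>t. chart (x(a := t))) differentiable at (x a)"
    by (intro differentiableI_vector[OF chart_has_vector_derivative])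
next
  fix a assume "a < 2 * (m * m)"
  then show "continuous_on (chart_dom \<sigma>) (partial_deriv a chart)"
    using continuous_on_tvec[of "chart_dom \<sigma>" a] by (simp add: partial_deriv_chart cong: continuous_on_cong)
next
  fix x c b assume x: "x \<in> chart_dom \<sigma>" and sum: "(\<Sum>a<2 * (m * m). c a *\<^sub>R partial_deriv a chart x) = 0"
    and b: "b < 2 * (m * m)"
  have det: "Determinants.det (frame (Bm x)) \<noteq> 0" using x by (auto simp: chart_dom_def)
  have "(\<Sum>a<2 * (m * m). c a *\<^sub>R tvec (Bm x) (Cm x) a) = 0"
    using sum by (simp add: partial_deriv_chart)
  then show "c b = 0" using tvec_independent[OF upper_Bm lower_Cm det] b by blast
qed

text \<open>The base \<open>2 * m\<close> is the Killing factor \<open>4 * m\<close> divided by the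
  2 of each wedge factor; the cardinality is that of \<open>wedge_power_darboux\<close> with
  \<open>m * m\<close> pairs.\<close>

definition density_const :: real where
  "density_const = (2 * m) ^ (m * m) *
     card {\<pi>. \<pi> permutes {..<2 * (m * m)} \<and> (\<forall>i<m * m. \<pi> (2 * i + 1) = partner (\<pi> (2 * i)))}"

lemma density_const_pos: "density_const > 0"
  using card_pair_permutations_pos[of "m * m"] m_gt_1 by (simp add: density_const_def)

lemma chart_density_chart:
  assumes \<sigma>: "\<sigma> = 1 \<or> \<sigma> = - 1" and x: "x \<in> chart_dom \<sigma>"
  shows "chart_density (orb \<sigma>) chart x = density_const"
proof -
  have det: "Determinants.det (frame (Bm x)) \<noteq> 0" using x by (auto simp: chart_dom_def)
  have "wedge_power (kks_form (chart x)) (m * m) (\<lambda>i. partial_deriv i chart x) =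
    (- (4 * real m) / 2) ^ (m * m) *
     card {\<pi>. \<pi> permutes {..<2 * (m * m)} \<and> (\<forall>i<m * m. \<pi> (2 * i + 1) = partner (\<pi> (2 * i)))}"
    by (rule wedge_power_darboux)
       (simp only: partial_deriv_chart chart_def kks_tvec[OF upper_Bm lower_Cm det])
  then show ?thesis
    by (simp add: chart_density_def orbit_dim_orb[OF \<sigma>] density_const_def abs_mult power_abs)
qed

end

section \<open>Divergence of the partition function\<close>

abbreviation lborel_prod :: "nat \<Rightarrow> (nat \<Rightarrow> real) measure" where
  "lborel_prod N \<equiv> Pi\<^sub>M {..<N} (\<lambda>_. lborel)"

text \<open>This is what lets a single chart decide divergence.\<close>

lemma liouville_measure_ge:
  assumes "orbit_chart Orb U \<phi>"
  shows "(\<integral>\<^sup>+ y. F y \<partial>chart_measure Orb U \<phi>) \<le> (\<integral>\<^sup>+ y. F y \<partial>liouville_measure Orb)"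
proof (rule nn_integral_mono_measure)
  let ?A = "{chart_measure Orb U \<phi> | U \<phi>. orbit_chart Orb U \<phi>}"
  have sets: "sets (chart_measure Orb V \<psi>) = sets borel" for V \<psi>
    by (simp add: chart_measure_def)
  \<comment> \<open>Comparing integrals along the order of measures requires equal sigma-algebras,
    so the supremum must first be seen to be a Borel measure.\<close>
  have "sets (liouville_measure Orb) = sigma_sets UNIV (\<Union>x\<in>?A. sets x)"
    unfolding liouville_measure_def using assms
    by (intro sets_Sup_eq) (auto simp: chart_measure_def)
  also have "(\<Union>x\<in>?A. sets x) = sets borel"
    using assms sets by (intro SUP_eq_const) auto
  also have "sigma_sets UNIV (sets (borel :: (real^'a^'a) measure)) = sets borel"
    using sets.sigma_sets_eq[of "borel :: (real^'a^'a) measure"] by simp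
  finally show "sets (chart_measure Orb U \<phi>) = sets (liouville_measure Orb)" by (simp add: sets)
  show "chart_measure Orb U \<phi> \<le> liouville_measure Orb"
    unfolding liouville_measure_def using assms by (intro Sup_upper) auto
qed

lemma lborel_distr_sign_eq:
  assumes "c = 1 \<or> c = (- 1 :: real)" "A \<in> sets borel"
  shows "emeasure lborel ((\<lambda>t. c * t) -` A) = emeasure lborel A"
proof (cases "c = 1")
  case True
  then show ?thesis by (simp add: vimage_def)
next
  case False
  then have c: "c = - 1" using assms(1) by simp
  have "emeasure lborel A = emeasure (distr lborel borel uminus) A" by (simp add: lborel_distr_uminus)
  also have "\<dots> = emeasure lborel (uminus -` A \<inter> space lborel)"
    using assms(2) by (intro emeasure_distr) auto
  finally show ?thesis by (simp add: c vimage_def)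
qed

text \<open>It suffices to compare boxes, where the claim reduces to the invariance of Lebesgue
  measure under reflection of the line.\<close>

lemma distr_lborel_prod_signs:
  fixes \<delta> :: "nat \<Rightarrow> real"
  assumes "\<And>i. i < N \<Longrightarrow> \<delta> i = 1 \<or> \<delta> i = - 1"
  shows "distr (lborel_prod N) (lborel_prod N) (\<lambda>x. \<lambda>i\<in>{..<N}. \<delta> i * x i) = lborel_prod N"
proof -
  interpret product_sigma_finite "\<lambda>_ :: nat. lborel :: real measure" ..
  let ?T = "\<lambda>x. \<lambda>i\<in>{..<N}. \<delta> i * x i"
  have T: "?T \<in> measurable (lborel_prod N) (lborel_prod N)"
    by (intro measurable_restrict) measurable
  show ?thesis
  proof (rule PiM_eqI)
    fix A :: "nat \<Rightarrow> real set" assume A: "\<And>i. i \<in> {..<N} \<Longrightarrow> A i \<in> sets lborel"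
    have vim: "(\<lambda>t. \<delta> i * t) -` A i \<in> sets lborel" if "i < N" for i
    proof -
      have "(\<lambda>t. \<delta> i * t) -` A i \<inter> space lborel \<in> sets lborel"
        using A[of i] that by (intro measurable_sets[of _ lborel borel]) auto
      then show ?thesis by simp
    qed
    have "?T -` Pi\<^sub>E {..<N} A \<inter> space (lborel_prod N) = Pi\<^sub>E {..<N} (\<lambda>i. (\<lambda>t. \<delta> i * t) -` A i)"
      by (auto simp: space_PiM PiE_iff)
    then have "emeasure (distr (lborel_prod N) (lborel_prod N) ?T) (Pi\<^sub>E {..<N} A) =
        emeasure (lborel_prod N) (Pi\<^sub>E {..<N} (\<lambda>i. (\<lambda>t. \<delta> i * t) -` A i))"
      using A T by (subst emeasure_distr) (auto intro!: sets_PiM_I_finite)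
    also have "\<dots> = (\<Prod>i<N. emeasure lborel ((\<lambda>t. \<delta> i * t) -` A i))"
      using vim by (intro emeasure_PiM) auto
    also have "\<dots> = (\<Prod>i<N. emeasure lborel (A i))"
      using assms A by (intro prod.cong lborel_distr_sign_eq) auto
    finally show "emeasure (distr (lborel_prod N) (lborel_prod N) ?T) (Pi\<^sub>E {..<N} A) =
        (\<Prod>i\<in>{..<N}. emeasure lborel (A i))" .
  qed auto
qed

lemma emeasure_lborel_open_nonempty:
  assumes "open X" "t \<in> (X :: real set)" shows "emeasure lborel X \<noteq> 0"
proof -
  obtain e where e: "e > 0" "ball t e \<subseteq> X" using assms by (rule openE)
  then have "emeasure lborel {t - e<..<t + e} \<le> emeasure lborel X"
    using assms(1) by (intro emeasure_mono) (auto simp: ball_eq_greaterThanLessThan)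
  then show ?thesis using e(1) by (auto simp: ennreal_eq_0_iff)
qed

context pairing
begin

lemma measurable_Bm: "Bm \<in> borel_measurable (lborel_prod (2 * (m * m)))"
  and measurable_Cm: "Cm \<in> borel_measurable (lborel_prod (2 * (m * m)))"
proof -
  have coord: "(\<lambda>x. x i) \<in> borel_measurable (lborel_prod (2 * (m * m)))" if "i < 2 * (m * m)" for i
    using measurable_component_singleton[of i "{..<2 * (m * m)}" "\<lambda>_. lborel"] that
    by (simp add: measurable_lborel1)
  show "Bm \<in> borel_measurable (lborel_prod (2 * (m * m)))" "Cm \<in> borel_measurable (lborel_prod (2 * (m * m)))"
    unfolding Bm_def[abs_def] Cm_def[abs_def]
    by (auto intro!: borel_measurable_sum borel_measurable_scaleR coord)
qed

lemma measurable_chart: "chart \<in> borel_measurable (lborel_prod (2 * (m * m)))"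
  unfolding chart_def[abs_def]
  by (rule borel_measurable_continuous_Pair[OF measurable_Bm measurable_Cm])
     (intro continuous_on_phi continuous_intros)

lemma chart_dom_sets: "chart_dom \<sigma> \<in> sets (lborel_prod (2 * (m * m)))"
proof -
  have "(\<lambda>x. Determinants.det (frame (Bm x))) \<in> borel_measurable (lborel_prod (2 * (m * m)))"
    by (rule borel_measurable_continuous_on[OF _ measurable_Bm])
       (intro continuous_on_det continuous_on_frame continuous_intros)
  then have "{x \<in> space (lborel_prod (2 * (m * m))). \<sigma> * Determinants.det (frame (Bm x)) > 0}
      \<in> sets (lborel_prod (2 * (m * m)))"
    by measurable
  then show ?thesis by (simp add: chart_dom_def coord_space_def space_PiM)
qed

lemma nn_integral_chart_measure:
  assumes \<sigma>: "\<sigma> = 1 \<or> \<sigma> = - 1" and F: "F \<in> borel_measurable borel"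
  shows "(\<integral>\<^sup>+ y. F y \<partial>chart_measure (orb \<sigma>) (chart_dom \<sigma>) chart) =
    density_const * (\<integral>\<^sup>+ x. F (chart x) * indicator (chart_dom \<sigma>) x \<partial>lborel_prod (2 * (m * m)))"
proof -
  let ?M = "lborel_prod (2 * (m * m))"
  let ?R = "restrict_space ?M (chart_dom \<sigma>)"
  have space_R: "space ?R \<subseteq> chart_dom \<sigma>" by (auto simp: space_restrict_space)
  have chart[measurable]: "chart \<in> borel_measurable ?R"
    using measurable_chart by (rule measurable_restrict_space1)
  have Fc[measurable]: "(\<lambda>x. F (chart x)) \<in> borel_measurable ?R"
    using measurable_compose[OF chart F] .
  \<comment> \<open>The density is known to be constant on the domain of the chart; measurability on
    the restricted space depends on these values alone.\<close>
  have "(\<lambda>x. ennreal (chart_density (orb \<sigma>) chart x)) \<in> borel_measurable ?R \<longleftrightarrow>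
      (\<lambda>x. ennreal density_const) \<in> borel_measurable ?R"
    using space_R by (intro measurable_cong) (auto simp: chart_density_chart[OF \<sigma>])
  then have dens: "(\<lambda>x. ennreal (chart_density (orb \<sigma>) chart x)) \<in> borel_measurable ?R" by simp
  have "(\<integral>\<^sup>+ y. F y \<partial>chart_measure (orb \<sigma>) (chart_dom \<sigma>) chart) =
      (\<integral>\<^sup>+ x. F (chart x) \<partial>density ?R (\<lambda>x. ennreal (chart_density (orb \<sigma>) chart x)))"
    unfolding chart_measure_def orbit_dim_orb[OF \<sigma>] using F chart by (intro nn_integral_distr) simp_all
  also have "\<dots> = (\<integral>\<^sup>+ x. ennreal (chart_density (orb \<sigma>) chart x) * F (chart x) \<partial>?R)"
    using dens Fc by (rule nn_integral_density)
  also have "\<dots> = (\<integral>\<^sup>+ x. ennreal density_const * F (chart x) \<partial>?R)"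
    using space_R by (intro nn_integral_cong) (auto simp: chart_density_chart[OF \<sigma>])
  also have "\<dots> = ennreal density_const * (\<integral>\<^sup>+ x. F (chart x) \<partial>?R)"
    using Fc by (rule nn_integral_cmult)
  also have "(\<integral>\<^sup>+ x. F (chart x) \<partial>?R) = (\<integral>\<^sup>+ x. F (chart x) * indicator (chart_dom \<sigma>) x \<partial>?M)"
    using chart_dom_sets by (intro nn_integral_restrict_space) auto
  finally show ?thesis .
qed

text \<open>The determinant condition only involves the even coordinates, so the domain contains a box
  whose odd sides are unbounded.\<close>

lemma emeasure_chart_dom:
  assumes "\<sigma> = 1 \<or> \<sigma> = - 1"
  shows "emeasure (lborel_prod (2 * (m * m))) (chart_dom \<sigma>) = \<infinity>"
proof -
  interpret product_sigma_finite "\<lambda>_ :: nat. lborel :: real measure" ..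
  let ?N = "2 * (m * m)" and ?O = "{x. \<sigma> * Determinants.det (frame (Bm x)) > 0}"
  have "\<exists>B. upper B \<and> \<sigma> * Determinants.det (frame B) > 0"
  proof (cases "\<sigma> = 1")
    case True
    then show ?thesis by (intro exI[of _ J]) (simp add: upper_J frame_J_eq)
  next
    case False
    have refl_J: "(refl ** J) $ i $ j = (if i = f 0 then - 1 else 1) * J $ i $ j" for i j
      by (simp add: matrix_matrix_mult_def refl_def if_distrib[of "\<lambda>x. x * _"] cong: if_cong)
    have "f 0 \<in> P" using m_gt_1 by (simp add: P_def)
    then have "frame (refl ** J) = refl"
      by (auto simp: vec_eq_iff frame_def refl_J) (auto simp: refl_def J_def s_eq_iff)
    moreover have "upper (refl ** J)" using upper_J by (simp add: upper_def refl_J)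
    ultimately show ?thesis using False assms by (intro exI[of _ "refl ** J"]) (simp add: det_refl)
  qed
  then obtain B where B: "upper B" "\<sigma> * Determinants.det (frame B) > 0" by blast
  define x0 where "x0 a = B $ p (a div 2) $ q (a div 2)" for a
  have "Bm x0 = B" unfolding x0_def[abs_def] using B(1) by (rule Bm_of_upper)
  then have x0: "x0 \<in> ?O" using B(2) by simp
  \<comment> \<open>\<open>open\<close> on functions refers to all natural indices; a basic box is
    taken there, and below only its even sides under \<open>?N\<close> are kept.\<close>
  have "openin (product_topology (\<lambda>i. euclidean) UNIV) ?O"
    using open_frame_det[of \<sigma>] by (simp only: open_fun_def)
  from product_topology_open_contains_basis[OF this x0]
  obtain X where X: "x0 \<in> Pi\<^sub>E UNIV X" "\<And>i. open (X i)" "Pi\<^sub>E UNIV X \<subseteq> ?O" by auto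
  define A where "A i = (if even i then X i else UNIV)" for i :: nat
  have "Pi\<^sub>E {..<?N} A \<subseteq> chart_dom \<sigma>"
  proof
    fix x assume x: "x \<in> Pi\<^sub>E {..<?N} A"
    \<comment> \<open>\<open>Bm\<close> ignores all other coordinates, so they may be borrowed from
      \<open>x0\<close> to land in the box.\<close>
    define y where "y i = (if i < ?N \<and> even i then x i else x0 i)" for i
    have "y \<in> Pi\<^sub>E UNIV X" using x X(1) by (auto simp: y_def A_def PiE_iff split: if_splits)
    then have "y \<in> ?O" using X(3) by blast
    moreover have "Bm y = Bm x" unfolding Bm_def by (intro sum.cong) (auto simp: y_def)
    ultimately show "x \<in> chart_dom \<sigma>" using x by (auto simp: chart_dom_def coord_space_def)
  qed
  then have "emeasure (lborel_prod ?N) (Pi\<^sub>E {..<?N} A) \<le> emeasure (lborel_prod ?N) (chart_dom \<sigma>)"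
    using chart_dom_sets by (rule emeasure_mono)
  moreover have "emeasure (lborel_prod ?N) (Pi\<^sub>E {..<?N} A) = (\<Prod>i<?N. emeasure lborel (A i))"
    using X(2) by (intro emeasure_PiM) (auto simp: A_def)
  moreover have "(\<Prod>i<?N. emeasure lborel (A i)) = \<infinity>"
  proof -
    \<comment> \<open>An unbounded side makes the product infinite only if no side has measure 0, as
      0 times infinity is 0 in \<open>ennreal\<close>. The side with index 1 is a whole
      line.\<close>
    have "emeasure lborel (A i) \<noteq> 0" for i
      using emeasure_lborel_open_nonempty[OF X(2), of "x0 i" i] X(1) by (auto simp: A_def PiE_iff)
    moreover have "1 < ?N" "emeasure lborel (A 1) = \<infinity>" using m_gt_1 by (simp_all add: A_def one_less_mult)
    ultimately show ?thesis unfolding infinity_ennreal_def ennreal_prod_eq_top by auto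
  qed
  ultimately show ?thesis by (simp add: top_unique)
qed

text \<open>The diagonal sign matrices of determinant 1 that act on the rows of \<open>B\<close>.
  The product condition preserves \<open>det (frame B)\<close> and hence the domain; the value 1
  outside \<open>P\<close> makes \<open>frame\<close> commute with the action.\<close>

definition even_signs :: "('n \<Rightarrow> real) set" where
  "even_signs = {\<epsilon>. (\<forall>i. \<epsilon> i = 1 \<or> \<epsilon> i = - 1) \<and> (\<forall>i. i \<notin> P \<longrightarrow> \<epsilon> i = 1) \<and> (\<Prod>i\<in>UNIV. \<epsilon> i) = 1}"

lemma finite_even_signs: "finite even_signs"
proof (rule finite_subset)
  show "even_signs \<subseteq> (UNIV \<rightarrow>\<^sub>E {1, - 1})" by (auto simp: even_signs_def)
qed (simp add: finite_PiE)

lemma one_in_even_signs: "(\<lambda>_. 1) \<in> even_signs"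
  by (auto simp: even_signs_def)

text \<open>Changing the signs at \<open>i\<close> and at a second element of \<open>P\<close> shows that the mean sign at \<open>i\<close>
  vanishes; this needs \<open>m > 1\<close>.\<close>

lemma sum_even_signs:
  assumes "i \<in> P" shows "(\<Sum>\<epsilon>\<in>even_signs. \<epsilon> i) = 0"
proof -
  have "\<not> P \<subseteq> {i}"
    using card_mono[of "{i}" P] card_P m_gt_1 by auto
  then obtain j where j: "j \<in> P" "j \<noteq> i" by auto
  define flip where "flip \<epsilon> k = (if k = i \<or> k = j then - \<epsilon> k else \<epsilon> k)" for \<epsilon> :: "'n \<Rightarrow> real" and k
  have flip_flip: "flip (flip \<epsilon>) = \<epsilon>" for \<epsilon> by (auto simp: flip_def)
  have flip_in: "flip \<epsilon> \<in> even_signs" if "\<epsilon> \<in> even_signs" for \<epsilon>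
  proof -
    have "(\<Prod>k\<in>UNIV. flip \<epsilon> k) = (\<Prod>k\<in>UNIV. (if k = i then - 1 else 1) * (if k = j then - 1 else 1) * \<epsilon> k)"
      using j by (intro prod.cong) (auto simp: flip_def)
    also have "\<dots> = (\<Prod>k\<in>UNIV. \<epsilon> k)" by (simp add: prod.distrib)
    finally show ?thesis using that assms j by (auto simp: even_signs_def flip_def[abs_def] minus_equation_iff)
  qed
  have "(\<Sum>\<epsilon>\<in>even_signs. \<epsilon> i) = (\<Sum>\<epsilon>\<in>even_signs. - \<epsilon> i)"
    by (rule sum.reindex_bij_witness[of _ flip flip]) (auto simp: flip_flip flip_in, auto simp: flip_def)
  then show ?thesis by (simp add: sum_negf)
qed

definition diag_signs :: "('n \<Rightarrow> real) \<Rightarrow> real^'n^'n" where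
  "diag_signs \<epsilon> = (\<chi> i j. if i = j then \<epsilon> i else 0)"

lemma diag_signs_mult_nth: "(diag_signs \<epsilon> ** X) $ i $ j = \<epsilon> i * X $ i $ j"
  by (simp add: matrix_matrix_mult_def diag_signs_def if_distrib[of "\<lambda>x. x * _"] cong: if_cong)

lemma det_diag_signs: "\<epsilon> \<in> even_signs \<Longrightarrow> Determinants.det (diag_signs \<epsilon>) = 1"
  by (subst det_diagonal) (simp_all add: diag_signs_def even_signs_def)

lemma frame_diag_signs: "\<epsilon> \<in> even_signs \<Longrightarrow> frame (diag_signs \<epsilon> ** X) = diag_signs \<epsilon> ** frame X"
  by (auto simp: vec_eq_iff frame_def diag_signs_mult_nth even_signs_def)

text \<open>Left multiplication of \<open>B\<close> by \<open>diag_signs\<close>, expressed in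
  coordinates; restricting the index set keeps the result in \<open>coord_space\<close>.\<close>

definition flip_coords :: "('n \<Rightarrow> real) \<Rightarrow> (nat \<Rightarrow> real) \<Rightarrow> nat \<Rightarrow> real" where
  "flip_coords \<epsilon> x = (\<lambda>a\<in>{..<2 * (m * m)}. (if even a then \<epsilon> (p (a div 2)) else 1) * x a)"

lemma Bm_flip_coords: "Bm (flip_coords \<epsilon> x) = diag_signs \<epsilon> ** Bm x"
proof -
  have "diag_signs \<epsilon> ** Bm x = (\<Sum>k<m * m. x (2 * k) *\<^sub>R (diag_signs \<epsilon> ** munit (p k) (q k)))"
    unfolding Bm_def
    by (simp add: bounded_bilinear.sum_right[OF bounded_bilinear_matrix_mult] matrix_mul_scaleR_right)
  also have "\<dots> = (\<Sum>k<m * m. (\<epsilon> (p k) * x (2 * k)) *\<^sub>R munit (p k) (q k))"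
    by (intro sum.cong) (auto simp: vec_eq_iff diag_signs_mult_nth munit_nth)
  also have "\<dots> = Bm (flip_coords \<epsilon> x)"
    unfolding Bm_def by (intro sum.cong) (auto simp: flip_coords_def)
  finally show ?thesis ..
qed

lemma Cm_flip_coords: "Cm (flip_coords \<epsilon> x) = Cm x"
  unfolding Cm_def by (intro sum.cong) (auto simp: flip_coords_def)

lemma flip_coords_in_chart_dom_iff:
  assumes "\<epsilon> \<in> even_signs" "x \<in> coord_space (2 * (m * m))"
  shows "flip_coords \<epsilon> x \<in> chart_dom \<sigma> \<longleftrightarrow> x \<in> chart_dom \<sigma>"
  using assms by (simp add: chart_dom_def Bm_flip_coords frame_diag_signs det_mul det_diag_signs)
    (simp add: coord_space_def flip_coords_def)

lemma nn_integral_flip_coords: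
  assumes "\<epsilon> \<in> even_signs" "F \<in> borel_measurable (lborel_prod (2 * (m * m)))"
  shows "(\<integral>\<^sup>+ x. F (flip_coords \<epsilon> x) \<partial>lborel_prod (2 * (m * m))) = (\<integral>\<^sup>+ x. F x \<partial>lborel_prod (2 * (m * m)))"
proof -
  let ?M = "lborel_prod (2 * (m * m))"
  have "distr ?M ?M (flip_coords \<epsilon>) = ?M"
    unfolding flip_coords_def[abs_def] using assms(1)
    by (intro distr_lborel_prod_signs) (auto simp: even_signs_def)
  moreover have "flip_coords \<epsilon> \<in> measurable ?M ?M"
    unfolding flip_coords_def[abs_def] by (intro measurable_restrict) measurable
  ultimately show ?thesis using assms(2) by (metis nn_integral_distr)
qed

text \<open>Cyclicity moves the factor \<open>1 + C\<close> to the end, leaving the diagonal sign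
  matrix times a matrix independent of the signs. Rows outside \<open>P\<close> drop out because
  \<open>B\<close> vanishes there.\<close>

lemma trace_chart_flip_coords:
  "\<exists>w. \<forall>\<epsilon>. trace (chart (flip_coords \<epsilon> x) ** \<beta>) = (\<Sum>i\<in>P. \<epsilon> i * w i)"
proof -
  let ?W = "Bm x ** ((Id_mat - Cm x) ** \<beta> ** (Id_mat + Cm x))"
  have "trace (chart (flip_coords \<epsilon> x) ** \<beta>) = (\<Sum>i\<in>P. \<epsilon> i * ?W $ i $ i)" for \<epsilon>
  proof -
    have "trace (chart (flip_coords \<epsilon> x) ** \<beta>) =
        trace ((Id_mat + Cm x) ** (diag_signs \<epsilon> ** Bm x ** (Id_mat - Cm x) ** \<beta>))"
      unfolding chart_def phi_def Bm_flip_coords Cm_flip_coords by (simp only: matrix_mul_assoc)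
    also have "\<dots> = trace (diag_signs \<epsilon> ** ?W)"
      by (subst trace_mul_sym) (simp only: matrix_mul_assoc)
    also have "\<dots> = (\<Sum>i\<in>UNIV. \<epsilon> i * ?W $ i $ i)" by (simp add: trace_def diag_signs_mult_nth)
    also have "\<dots> = (\<Sum>i\<in>P. \<epsilon> i * ?W $ i $ i)"
    proof (rule sum.mono_neutral_right)
      have "?W $ i $ i = 0" if "i \<notin> P" for i
        using that upper_Bm[of x] by (simp add: matrix_matrix_mult_def[of "Bm x"] upperD)
      then show "\<forall>i\<in>UNIV - P. \<epsilon> i * ?W $ i $ i = 0" by simp
    qed auto
    finally show ?thesis .
  qed
  then show ?thesis by (intro exI[of _ "\<lambda>i. ?W $ i $ i"]) simp
qed

text \<open>Bound \<open>exp t\<close> from below by \<open>1 + t\<close>: the linear terms cancel.\<close>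

lemma sum_exp_flip_coords_ge:
  "(\<Sum>\<epsilon>\<in>even_signs. exp (c * trace (chart (flip_coords \<epsilon> x) ** \<beta>))) \<ge> 1"
proof -
  obtain w where w: "\<And>\<epsilon>. trace (chart (flip_coords \<epsilon> x) ** \<beta>) = (\<Sum>i\<in>P. \<epsilon> i * w i)"
    using trace_chart_flip_coords by blast
  have "(\<Sum>\<epsilon>\<in>even_signs. \<Sum>i\<in>P. \<epsilon> i * w i) = (\<Sum>i\<in>P. (\<Sum>\<epsilon>\<in>even_signs. \<epsilon> i) * w i)"
    by (subst sum.swap) (simp add: sum_distrib_right)
  then have zero: "(\<Sum>\<epsilon>\<in>even_signs. \<Sum>i\<in>P. \<epsilon> i * w i) = 0" by (simp add: sum_even_signs)
  have "card even_signs > 0" using finite_even_signs one_in_even_signs by (auto simp: card_gt_0_iff)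
  then have "1 \<le> real (card even_signs)" by linarith
  also have "\<dots> = (\<Sum>\<epsilon>\<in>even_signs. 1 + c * (\<Sum>i\<in>P. \<epsilon> i * w i))"
    by (simp add: sum.distrib zero flip: sum_distrib_left)
  also have "\<dots> \<le> (\<Sum>\<epsilon>\<in>even_signs. exp (c * trace (chart (flip_coords \<epsilon> x) ** \<beta>)))"
    unfolding w by (intro sum_mono exp_ge_add_one_self)
  finally show ?thesis .
qed

text \<open>All sign changes give the same integral, so finitely many copies of it add up to the
  integral of the sum. That sum is at least the indicator of the domain, whose volume is infinite;
  hence a single copy is infinite.\<close>

lemma nn_integral_exp_chart:
  assumes "\<sigma> = 1 \<or> \<sigma> = - 1"
  shows "(\<integral>\<^sup>+ x. ennreal (exp (c * trace (chart x ** \<beta>))) * indicator (chart_dom \<sigma>) x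
    \<partial>lborel_prod (2 * (m * m))) = \<infinity>" (is "integral\<^sup>N ?M ?F = _")
proof -
  have [measurable]: "chart \<in> borel_measurable ?M" "chart_dom \<sigma> \<in> sets ?M"
    by (rule measurable_chart chart_dom_sets)+
  have exp_meas: "(\<lambda>x. exp (c * trace (chart x ** \<beta>))) \<in> borel_measurable ?M"
    by (rule borel_measurable_continuous_on[OF _ measurable_chart])
       (auto simp: trace_def intro!: continuous_intros continuous_on_matrix_mult)
  then have F: "?F \<in> borel_measurable ?M" by measurable
  have flip_meas: "(\<lambda>x. ?F (flip_coords \<epsilon> x)) \<in> borel_measurable ?M" for \<epsilon>
  proof (rule measurable_compose[OF _ F])
    show "flip_coords \<epsilon> \<in> measurable ?M ?M"
      unfolding flip_coords_def[abs_def] by (intro measurable_restrict) measurable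
  qed
  have "\<infinity> = emeasure ?M (chart_dom \<sigma>)" using assms by (simp add: emeasure_chart_dom)
  also have "\<dots> = (\<integral>\<^sup>+ x. indicator (chart_dom \<sigma>) x \<partial>?M)" by (simp add: chart_dom_sets)
  also have "\<dots> \<le> (\<integral>\<^sup>+ x. (\<Sum>\<epsilon>\<in>even_signs. ?F (flip_coords \<epsilon> x)) \<partial>?M)"
  proof (rule nn_integral_mono)
    fix x assume "x \<in> space ?M"
    then have x: "x \<in> coord_space (2 * (m * m))" by (simp add: space_PiM coord_space_def)
    have "(\<Sum>\<epsilon>\<in>even_signs. ?F (flip_coords \<epsilon> x)) =
        (\<Sum>\<epsilon>\<in>even_signs. ennreal (exp (c * trace (chart (flip_coords \<epsilon> x) ** \<beta>)))) * indicator (chart_dom \<sigma>) x"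
      unfolding sum_distrib_right
      by (intro sum.cong) (auto simp: flip_coords_in_chart_dom_iff[OF _ x] indicator_def)
    also have "(\<Sum>\<epsilon>\<in>even_signs. ennreal (exp (c * trace (chart (flip_coords \<epsilon> x) ** \<beta>)))) =
        ennreal (\<Sum>\<epsilon>\<in>even_signs. exp (c * trace (chart (flip_coords \<epsilon> x) ** \<beta>)))"
      by (intro sum_ennreal) auto
    also have "\<dots> * indicator (chart_dom \<sigma>) x \<ge> 1 * indicator (chart_dom \<sigma>) x"
      unfolding ennreal_1[symmetric] by (intro mult_right_mono ennreal_leI sum_exp_flip_coords_ge) simp
    finally show "indicator (chart_dom \<sigma>) x \<le> (\<Sum>\<epsilon>\<in>even_signs. ?F (flip_coords \<epsilon> x))" by simp
  qed
  also have "\<dots> = (\<Sum>\<epsilon>\<in>even_signs. \<integral>\<^sup>+ x. ?F (flip_coords \<epsilon> x) \<partial>?M)"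
    using flip_meas by (intro nn_integral_sum)
  also have "\<dots> = (\<Sum>\<epsilon>\<in>even_signs. integral\<^sup>N ?M ?F)"
    using F by (intro sum.cong nn_integral_flip_coords) auto
  also have "\<dots> = of_nat (card even_signs) * integral\<^sup>N ?M ?F" by simp
  finally have "of_nat (card even_signs) * integral\<^sup>N ?M ?F = \<infinity>" by (simp add: top_unique)
  then show ?thesis by (auto simp: ennreal_mult_eq_top_iff)
qed

lemma gibbs_domain_orb:
  assumes \<sigma>: "\<sigma> = 1 \<or> \<sigma> = - 1"
  shows "gibbs_domain (orb \<sigma>) = {}"
proof -
  have "partition_function (orb \<sigma>) \<beta> = \<infinity>" if "\<beta> \<in> sl" for \<beta>
  proof -
    \<comment> \<open>\<open>\<beta>\<close> has trace 0, so the product of traces drops out of the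
      Killing form and \<open>2 * CARD('n)\<close> is \<open>4 * m\<close>.\<close>
    have kill: "- killing y \<beta> = - (4 * real m) * trace (y ** \<beta>)" for y
      using that by (simp add: killing_eq card_n sl_def)
    have "(\<lambda>y. ennreal (exp (- (4 * real m) * trace (y ** \<beta>)))) \<in> borel_measurable borel"
      by (intro measurable_compose[OF _ measurable_ennreal] borel_measurable_continuous_onI)
         (auto simp: trace_def intro!: continuous_intros continuous_on_matrix_mult)
    then have "(\<integral>\<^sup>+ y. ennreal (exp (- killing y \<beta>)) \<partial>chart_measure (orb \<sigma>) (chart_dom \<sigma>) chart) =
      density_const * (\<integral>\<^sup>+ x. ennreal (exp (- (4 * real m) * trace (chart x ** \<beta>))) *
        indicator (chart_dom \<sigma>) x \<partial>lborel_prod (2 * (m * m)))"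
      unfolding kill by (rule nn_integral_chart_measure[OF \<sigma>])
    also have "\<dots> = \<infinity>"
      unfolding nn_integral_exp_chart[OF \<sigma>]
      using density_const_pos by (simp add: ennreal_mult_top ennreal_eq_0_iff not_le)
    finally show ?thesis
      using liouville_measure_ge[OF orbit_chart_chart[OF \<sigma>], of "\<lambda>y. ennreal (exp (- killing y \<beta>))"]
      by (simp add: partition_function_def top_unique)
  qed
  then show ?thesis by (auto simp: gibbs_domain_def)
qed

end

theorem theorem4p14:
  fixes m :: nat
  assumes "CARD('n::finite) = 2 * m" and "m > 1"
  shows "(nilpotents_2 :: (real^'n^'n) set) = {x \<in> sl. x ** x = 0 \<and> rank x = m} \<and>
    (\<exists>Orb1\<in>adjoint_orbits. \<exists>Orb2\<in>adjoint_orbits. Orb1 \<noteq> Orb2 \<and>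
       (nilpotents_2 :: (real^'n^'n) set) = Orb1 \<union> Orb2 \<and>
       gibbs_domain Orb1 = {} \<and> gibbs_domain Orb2 = {})"
proof -
  obtain f where f: "bij_betw f {..<2 * m} (UNIV :: 'n set)"
    using ex_bij_betw_nat_finite[of "UNIV :: 'n set"] assms(1) by (auto simp: lessThan_atLeast0)
  interpret pairing m f
    using assms f by unfold_locales
  have "orb 1 \<in> adjoint_orbits" "orb (- 1) \<in> adjoint_orbits"
    using J_in_sl by (auto simp: adjoint_orbits_def orb_pos orb_neg)
  moreover have "orb 1 \<noteq> orb (- 1)" using orb_disjoint orb_nonempty by auto
  ultimately show ?thesis
    using nilpotents_2_eq[OF assms] orb_union gibbs_domain_orb by blast
qed

end
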